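(* Let $K$ be an infinite countable field. A subset $S\subset K$ is affinely syndetic if and only if it has positive upper density with respect to any double Følner sequence in $K$. In particular, if $\big(X,\mathcal{B},\mu,(T_g)_{g\in\mathcal{A}_K}\big)$ is a probability measure preserving system, $B\in\mathcal{B}$ and $\delta\in(0,1)$, then the set $$R(B,\delta):=\Big\{u\in K,\ u\neq0:\ \mu\big(T_{M_u}^{-1}B\cap T_{A_u}^{-1}B\big)>\delta\mu(B)^2\Big\}$$ is affinely syndetic.
   Context: $\mathcal{A}_K$ is the affine group of $K$, i.e. the group under composition of all maps $x\mapsto vx+u$ with $u,v\in K$, $v\neq0$; $A_u:x\mapsto x+u$ for $u\in K$, and $M_u:x\mapsto ux$ for $u\in K\setminus\{0\}$. A probability measure preserving system $\big(X,\mathcal{B},\mu,(T_g)_{g\in\mathcal{A}_K}\big)$ is a probability space $(X,\mathcal{B},\mu)$ with an action of $\mathcal{A}_K$ by measurable maps $T_g:X\to X$ satisfying $T_gT_h=T_{gh}$ and $\mu(T_g^{-1}B)=\mu(B)$ for all $B\in\mathcal{B}$. A set $S\subset K$ is affinely syndetic if there are finitely many $g_1,\dots,g_k\in\mathcal{A}_K$ such that for any $x\in K$ at least one of the images $g_1(x),\dots,g_k(x)$ lies in $S$. A double Følner sequence in $K$ is a sequence $(F_N)_{N\in\mathbb{N}}$ of finite nonempty subsets of $K$ such that for every $u\in K\setminus\{0\}$, $\lim_{N\to\infty}|F_N\cap(F_N+u)|/|F_N|=\lim_{N\to\infty}|F_N\cap(F_Nu)|/|F_N|=1$. The upper density of $E\subset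 K$ with respect to $(F_N)$ is $\bar d_{(F_N)}(E)=\limsup_{N\to\infty}|E\cap F_N|/|F_N|$.
   Formalization: In the second part the set B is additionally assumed to have positive measure μ(B) > 0; if μ(B) = 0 then R(B,δ) is empty and hence not affinely syndetic, so the claim as written fails. *)

theory Defs
  imports "HOL-Probability.Probability"
begin

definition affine_group :: "('k::field \<Rightarrow> 'k) set" where
  "affine_group = {\<lambda>x. v * x + u |u v. v \<noteq> 0}"

definition add_map :: "'k::field \<Rightarrow> 'k \<Rightarrow> 'k" where
  "add_map u = (\<lambda>x. x + u)"

definition mult_map :: "'k::field \<Rightarrow> 'k \<Rightarrow> 'k" where
  "mult_map u = (\<lambda>x. u * x)"

definition affinely_syndetic :: "'k::field set \<Rightarrow> bool" where
  "affinely_syndetic S \<longleftrightarrow>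
     (\<exists>G. finite G \<and> G \<subseteq> affine_group \<and> (\<forall>x. \<exists>g\<in>G. g x \<in> S))"

definition double_folner :: "(nat \<Rightarrow> 'k::field set) \<Rightarrow> bool" where
  "double_folner F \<longleftrightarrow>
     (\<forall>N. finite (F N) \<and> F N \<noteq> {}) \<and>
     (\<forall>u. u \<noteq> 0 \<longrightarrow>
        (\<lambda>N. real (card (F N \<inter> (\<lambda>x. x + u) ` F N)) / real (card (F N))) \<longlonglongrightarrow> 1 \<and>
        (\<lambda>N. real (card (F N \<inter> (\<lambda>x. x * u) ` F N)) / real (card (F N))) \<longlonglongrightarrow> 1)"

definition upper_density :: "(nat \<Rightarrow> 'k set) \<Rightarrow> 'k set \<Rightarrow> ereal" where
  "upper_density F E = limsup (\<lambda>N. ereal (real (card (E \<inter> F N)) / real (card (F N))))"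

text \<open>A probability measure preserving action of the affine group. The map \<open>T\<close> is
  constrained only at arguments in \<open>affine_group\<close> and only on points of \<open>space M\<close>.
  The identity law is part of being a group action and does not follow from
  multiplicativity.\<close>

locale affine_pmp_system = prob_space M
  for M :: "'x measure" and T :: "('k::field \<Rightarrow> 'k) \<Rightarrow> 'x \<Rightarrow> 'x" +
  assumes T_measurable: "g \<in> affine_group \<Longrightarrow> T g \<in> measurable M M"
    and T_id: "x \<in> space M \<Longrightarrow> T id x = x"
    and T_comp: "g \<in> affine_group \<Longrightarrow> h \<in> affine_group \<Longrightarrow> x \<in> space M \<Longrightarrow>
                   T g (T h x) = T (g \<circ> h) x"
    and T_preserving: "g \<in> affine_group \<Longrightarrow> B \<in> sets M \<Longrightarrow>
                   measure M (T g -` B \<inter> space M) = measure M B"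

definition return_set ::
  "'x measure \<Rightarrow> (('k::field \<Rightarrow> 'k) \<Rightarrow> 'x \<Rightarrow> 'x) \<Rightarrow> 'x set \<Rightarrow> real \<Rightarrow> 'k set" where
  "return_set M T B \<delta> =
     {u. u \<noteq> 0 \<and>
         measure M ((T (mult_map u) -` B \<inter> space M) \<inter> (T (add_map u) -` B \<inter> space M))
           > \<delta> * (measure M B)\<^sup>2}"

end

theory Submission
  imports Defs "HOL-Real_Asymp.Real_Asymp" "HOL-Library.Function_Algebras"
begin

text \<open>Densities along a double Folner sequence are asymptotically invariant under affine maps, so a set
  finitely many of whose affine preimages cover \<open>K\<close> has positive density. Conversely, if \<open>S\<close> is not
  affinely syndetic, its complement contains the image of some point under any prescribed finite set of
  affine maps. For a finite set \<open>V\<close> almost invariant under prescribed dilations and then a finite set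
  \<open>W\<close> almost invariant under the translations by \<open>u / v\<close>, \<open>v \<in> V\<close>, the set of all \<open>v * (x + w)\<close>
  is almost invariant under both dilations by and translations by \<open>u\<close>, and \<open>x\<close> can be chosen to
  place it outside \<open>S\<close>. Almost invariant sets exist by polynomial growth of abelian groups.

  For the return set it is thus enough to bound from below the averages of
  \<open>\<langle>f \<circ> T(A\<^sub>u), f \<circ> T(M\<^sub>u)\<rangle>\<close> along a double Folner sequence avoiding \<open>0\<close>, where \<open>f = 1\<^sub>B\<close>.
  Projections onto invariant vectors are replaced by
  elements of almost minimal norm: \<open>c\<close> in the convex hull of the translates of \<open>f\<close> is almost
  invariant under translations, and \<open>d\<close> in the convex hull of the dilates of \<open>c\<close> is almost invariant
  under the whole group. Van der Corput's trick shows that \<open>f - c\<close> contributes nothing to the average,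
  \<open>c - d\<close> contributes nothing by invariance of the averages under dilations, and
  \<open>\<langle>d, f\<rangle>\<close> is almost \<open>\<langle>d, d\<rangle> \<ge> (\<integral>d)\<^sup>2 = (\<integral>f)\<^sup>2\<close>.\<close>

section \<open>Averages along double Folner sequences\<close>

definition avg :: "'a set \<Rightarrow> ('a \<Rightarrow> real) \<Rightarrow> real" where
  "avg A a = (\<Sum>u\<in>A. a u) / real (card A)"

lemma avg_add: "avg A (\<lambda>u. a u + b u) = avg A a + avg A b"
  by (simp add: avg_def sum.distrib add_divide_distrib)

lemma avg_diff: "avg A (\<lambda>u. a u - b u) = avg A a - avg A b"
  by (simp add: avg_def sum_subtractf diff_divide_distrib)

lemma avg_cmult: "avg A (\<lambda>u. c * a u) = c * avg A a"
  by (simp add: avg_def sum_distrib_left)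

lemma avg_sum: "avg A (\<lambda>u. \<Sum>i\<in>I. a i u) = (\<Sum>i\<in>I. avg A (a i))"
  unfolding avg_def by (subst sum.swap) (simp add: sum_divide_distrib)

lemma avg_const: "finite A \<Longrightarrow> A \<noteq> {} \<Longrightarrow> avg A (\<lambda>u. c) = c"
  by (simp add: avg_def)

lemma avg_mono: "(\<And>u. u \<in> A \<Longrightarrow> a u \<le> b u) \<Longrightarrow> avg A a \<le> avg A b"
  unfolding avg_def by (intro divide_right_mono sum_mono) auto

lemma avg_cong: "(\<And>u. u \<in> A \<Longrightarrow> a u = b u) \<Longrightarrow> avg A a = avg A b"
  by (simp add: avg_def)

text \<open>Nonnegativity of the variance.\<close>

lemma avg_square_le:
  assumes "finite A" "A \<noteq> {}"
  shows "(avg A a)\<^sup>2 \<le> avg A (\<lambda>u. (a u)\<^sup>2)"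
proof -
  define m where "m = avg A a"
  have "0 \<le> avg A (\<lambda>u. (a u - m)\<^sup>2)"
    unfolding avg_def by (intro divide_nonneg_nonneg sum_nonneg) auto
  also have "(\<lambda>u. (a u - m)\<^sup>2) = (\<lambda>u. ((a u)\<^sup>2 - (2 * m) * a u) + m\<^sup>2)"
    by (auto simp: power2_eq_square algebra_simps)
  also have "avg A \<dots> = avg A (\<lambda>u. (a u)\<^sup>2) - m\<^sup>2"
    using assms by (simp add: avg_add avg_diff avg_cmult avg_const m_def power2_eq_square)
  finally show ?thesis by (simp add: m_def)
qed

text \<open>Reindexing along \<open>\<sigma>\<close> cancels the common part of \<open>A\<close> and
  \<open>\<sigma>\<close> A\<open>. What is left are sums over the two halves of the symmetric
  difference, each with\<close>card A - card (A \<inter> \<sigma> \<open>A)\<close>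
  elements.\<close>

lemma abs_avg_image_diff_le:
  assumes fin: "finite A" and ne: "A \<noteq> {}" and inj: "inj_on \<sigma> A" and bd: "\<And>u. u \<in> A \<union> \<sigma> ` A \<Longrightarrow> \<bar>a u\<bar> \<le> C"
  shows "\<bar>avg A (\<lambda>u. a (\<sigma> u)) - avg A a\<bar>
           \<le> 2 * C * (1 - real (card (A \<inter> \<sigma> ` A)) / real (card A))"
proof -
  let ?B = "\<sigma> ` A"
  have cA: "card A > 0" using fin ne by (simp add: card_gt_0_iff)
  have "(\<Sum>u\<in>A. a (\<sigma> u)) - (\<Sum>u\<in>A. a u) = sum a ?B - sum a A"
    using inj by (simp add: sum.reindex)
  also have "\<dots> = sum a (?B - A) - sum a (A - ?B)"
    using fin sum.Int_Diff[of ?B a A] sum.Int_Diff[of A a ?B] by (simp add: Int_commute)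
  finally have eq: "(\<Sum>u\<in>A. a (\<sigma> u)) - (\<Sum>u\<in>A. a u) = sum a (?B - A) - sum a (A - ?B)" .
  have b1: "\<bar>sum a (?B - A)\<bar> \<le> real (card (?B - A)) * C"
    by (rule order_trans[OF sum_abs sum_bounded_above]) (use bd in auto)
  have b2: "\<bar>sum a (A - ?B)\<bar> \<le> real (card (A - ?B)) * C"
    by (rule order_trans[OF sum_abs sum_bounded_above]) (use bd in auto)
  have c1: "real (card (A - ?B)) = real (card A) - real (card (A \<inter> ?B))"
    using fin card_Diff_subset_Int[of A ?B] card_mono[of A "A \<inter> ?B"] by (simp add: of_nat_diff)
  have "card (?B - A) = card ?B - card (A \<inter> ?B)"
    using fin card_Diff_subset_Int[of ?B A] by (simp add: Int_commute)
  then have c2: "real (card (?B - A)) = real (card A) - real (card (A \<inter> ?B))"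
    using fin card_mono[of A "A \<inter> ?B"] card_image[OF inj] by (simp add: of_nat_diff)
  have "\<bar>(\<Sum>u\<in>A. a (\<sigma> u)) - (\<Sum>u\<in>A. a u)\<bar> \<le> 2 * C * (real (card A) - real (card (A \<inter> ?B)))"
    using b1 b2 unfolding eq c1 c2 by (simp add: algebra_simps)
  then have "\<bar>(\<Sum>u\<in>A. a (\<sigma> u)) - (\<Sum>u\<in>A. a u)\<bar> / card A
      \<le> 2 * C * (real (card A) - real (card (A \<inter> ?B))) / card A"
    by (rule divide_right_mono) simp
  also have "\<dots> = 2 * C * (1 - real (card (A \<inter> ?B)) / real (card A))"
    using cA by (simp add: field_simps)
  finally show ?thesis
    by (simp add: avg_def flip: diff_divide_distrib)
qed

text \<open>The domain \<open>D\<close> allows for functions that are controlled only away from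
  \<open>0\<close>; for dilations it is later taken to be \<open>- {0}\<close>.\<close>

lemma avg_image_diff_tendsto_0:
  assumes fin: "\<And>N. finite (F N)" "\<And>N. F N \<noteq> {}" and sub: "\<And>N. F N \<subseteq> D"
    and inj: "inj \<sigma>" and \<sigma>: "\<sigma> ` D \<subseteq> D"
    and lim: "(\<lambda>N. real (card (F N \<inter> \<sigma> ` F N)) / real (card (F N))) \<longlonglongrightarrow> 1"
    and bd: "\<And>u. u \<in> D \<Longrightarrow> \<bar>a u\<bar> \<le> C"
  shows "(\<lambda>N. avg (F N) (\<lambda>u. a (\<sigma> u)) - avg (F N) a) \<longlonglongrightarrow> 0"
proof (rule Lim_null_comparison)
  show "\<forall>\<^sub>F N in sequentially. norm (avg (F N) (\<lambda>u. a (\<sigma> u)) - avg (F N) a)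
      \<le> 2 * C * (1 - real (card (F N \<inter> \<sigma> ` F N)) / real (card (F N)))"
    unfolding real_norm_def using sub \<sigma>
    by (intro always_eventually allI abs_avg_image_diff_le fin bd inj_on_subset[OF inj]) auto
  show "(\<lambda>N. 2 * C * (1 - real (card (F N \<inter> \<sigma> ` F N)) / real (card (F N)))) \<longlonglongrightarrow> 0"
    by (rule tendsto_eq_intros lim refl)+ simp
qed

section \<open>Asymptotic invariance of averages under affine maps\<close>

lemma
  assumes "double_folner F"
  shows double_folner_finite: "finite (F N)" and double_folner_nonempty: "F N \<noteq> {}"
  using assms by (auto simp: double_folner_def)

lemma double_folner_avg_add:
  fixes F :: "nat \<Rightarrow> 'k::field set"
  assumes F: "double_folner F" and bd: "\<And>u. \<bar>a u\<bar> \<le> C"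
  shows "(\<lambda>N. avg (F N) (\<lambda>u. a (u + w)) - avg (F N) a) \<longlonglongrightarrow> 0"
proof (cases "w = 0")
  case False
  then show ?thesis
    using F bd by (intro avg_image_diff_tendsto_0[where D = UNIV]) (auto simp: double_folner_def)
qed simp

lemma double_folner_avg_mult:
  fixes F :: "nat \<Rightarrow> 'k::field set"
  assumes F: "double_folner F" and "w \<noteq> 0"
    and sub: "\<And>N. F N \<subseteq> D" and D: "(\<lambda>u. u * w) ` D \<subseteq> D"
    and bd: "\<And>u. u \<in> D \<Longrightarrow> \<bar>a u\<bar> \<le> C"
  shows "(\<lambda>N. avg (F N) (\<lambda>u. a (u * w)) - avg (F N) a) \<longlonglongrightarrow> 0"
  using assms by (intro avg_image_diff_tendsto_0[where D = D]) (auto simp: double_folner_def inj_def)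

lemma double_folner_avg_affine:
  fixes F :: "nat \<Rightarrow> 'k::field set"
  assumes F: "double_folner F" and g: "g \<in> affine_group" and bd: "\<And>u. \<bar>a u\<bar> \<le> C"
  shows "(\<lambda>N. avg (F N) (\<lambda>u. a (g u)) - avg (F N) a) \<longlonglongrightarrow> 0"
proof -
  obtain v w where v: "v \<noteq> 0" and g_eq: "g = (\<lambda>x. v * x + w)"
    using g by (auto simp: affine_group_def)
  have "(\<lambda>N. (avg (F N) (\<lambda>u. a (u * v + w)) - avg (F N) (\<lambda>u. a (u + w)))
      + (avg (F N) (\<lambda>u. a (u + w)) - avg (F N) a)) \<longlonglongrightarrow> 0 + 0"
    using F v bd
    by (intro tendsto_add double_folner_avg_add[where C = C]
        double_folner_avg_mult[where a = "\<lambda>u. a (u + w)" and D = UNIV and C = C]) auto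
  then show ?thesis by (simp add: g_eq mult.commute)
qed

lemma avg_indicator: "finite A \<Longrightarrow> avg A (indicator S) = real (card (S \<inter> A)) / real (card A)"
  by (simp add: avg_def indicator_def sum.If_cases Int_commute)

text \<open>The \<open>k\<close> indicators of the preimages of \<open>S\<close> under
  \<open>G\<close> add up to at least \<open>1\<close> at every point, while each has asymptotically
  the same average \<open>d N\<close> as \<open>S\<close> itself. So \<open>k * d N\<close> is at
  least \<open>1/2\<close> from some \<open>N\<close> on.\<close>

lemma affinely_syndetic_imp_upper_density_pos:
  fixes S :: "'k::field set"
  assumes "affinely_syndetic S" and F: "double_folner F"
  shows "upper_density F S > 0"
proof -
  obtain G where G: "finite G" "G \<subseteq> affine_group" "\<And>x. \<exists>g\<in>G. g x \<in> S"
    using assms(1) by (auto simp: affinely_syndetic_def)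
  define k where "k = real (card G)"
  have "G \<noteq> {}" using G(3) by auto
  then have k: "k > 0" using G(1) by (simp add: k_def card_gt_0_iff)
  define d where "d N = avg (F N) (indicator S)" for N
  have "(\<lambda>N. \<Sum>g\<in>G. avg (F N) (\<lambda>u. indicator S (g u)) - d N) \<longlonglongrightarrow> (\<Sum>g\<in>G. 0)"
    unfolding d_def using G(2)
    by (intro tendsto_sum double_folner_avg_affine[OF F, where C = 1]) (auto simp: indicator_def)
  then have "(\<lambda>N. (\<Sum>g\<in>G. avg (F N) (\<lambda>u. indicator S (g u))) - k * d N) \<longlonglongrightarrow> 0"
    by (simp add: sum_subtractf k_def)
  then have "\<forall>\<^sub>F N in sequentially. (\<Sum>g\<in>G. avg (F N) (\<lambda>u. indicator S (g u))) - k * d N < 1/2"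
    by (rule order_tendstoD) simp
  moreover have "1 \<le> (\<Sum>g\<in>G. avg (F N) (\<lambda>u. indicator S (g u)))" for N
  proof -
    have "1 = avg (F N) (\<lambda>u. 1)"
      using F by (simp add: avg_const double_folner_finite double_folner_nonempty)
    also have "\<dots> \<le> avg (F N) (\<lambda>u. \<Sum>g\<in>G. indicator S (g u))"
    proof (rule avg_mono)
      fix u
      obtain g where "g \<in> G" "g u \<in> S" using G(3) by blast
      then show "1 \<le> (\<Sum>g\<in>G. indicator S (g u) :: real)"
        using member_le_sum[of g G "\<lambda>g. indicator S (g u) :: real"] G(1) by auto
    qed
    finally show ?thesis by (simp add: avg_sum)
  qed
  ultimately have "\<forall>\<^sub>F N in sequentially. 1 / (2 * k) \<le> d N"
    by (elim eventually_mono) (use k in \<open>simp add: field_simps, smt (verit)\<close>)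
  then have "\<forall>\<^sub>F N in sequentially. ereal (1 / (2 * k)) \<le> ereal (real (card (S \<inter> F N)) / real (card (F N)))"
    using F by (simp add: d_def avg_indicator double_folner_finite)
  then have "ereal (1 / (2 * k)) \<le> upper_density F S"
    unfolding upper_density_def by (rule le_Limsup[OF sequentially_bot])
  then show ?thesis
    using k by (smt (verit) ereal_less(2) less_le_trans zero_less_divide_1_iff)
qed

section \<open>Double Folner sequences avoiding a non-syndetic set\<close>

text \<open>\<open>P n\<close> consists of the images of \<open>x0\<close> under words in which each
  map of \<open>H\<close> is used at most \<open>n\<close> times. A new map \<open>h\<close>
  contributes the powers \<open>h ^^ i\<close> with \<open>i \<le> n\<close>, hence one more factor
  \<open>Suc n\<close>; the older maps pass these powers by commutativity.\<close>

lemma polynomial_growth_commuting_maps: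
  assumes "finite H" and "\<And>h h' x. h \<in> H \<Longrightarrow> h' \<in> H \<Longrightarrow> h (h' x) = h' (h x)"
    and "x0 \<in> D" and "\<And>h. h \<in> H \<Longrightarrow> h ` D \<subseteq> D"
  shows "\<exists>P :: nat \<Rightarrow> 'a set. \<forall>n. finite (P n) \<and> P n \<noteq> {} \<and> P n \<subseteq> D \<and> P n \<subseteq> P (Suc n) \<and>
           card (P n) \<le> Suc n ^ card H \<and> (\<forall>h\<in>H. h ` P n \<subseteq> P (Suc n))"
  using assms(1,2,4)
proof (induction H rule: finite_induct)
  case empty
  show ?case by (rule exI[of _ "\<lambda>_. {x0}"]) (use assms(3) in auto)
next
  case (insert h H)
  have "\<exists>P :: nat \<Rightarrow> 'a set. \<forall>n. finite (P n) \<and> P n \<noteq> {} \<and> P n \<subseteq> D \<and> P n \<subseteq> P (Suc n) \<and>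
           card (P n) \<le> Suc n ^ card H \<and> (\<forall>h\<in>H. h ` P n \<subseteq> P (Suc n))"
    by (rule insert.IH) (use insert.prems in blast)+
  then obtain P where "\<forall>n. finite (P n) \<and> P n \<noteq> {} \<and> P n \<subseteq> D \<and> P n \<subseteq> P (Suc n) \<and>
           card (P n) \<le> Suc n ^ card H \<and> (\<forall>h\<in>H. h ` P n \<subseteq> P (Suc n))" ..
  then have P:  "\<And>n. finite (P n)" "\<And>n. P n \<noteq> {}" "\<And>n. P n \<subseteq> D"
    "\<And>n. P n \<subseteq> P (Suc n)" "\<And>n. card (P n) \<le> Suc n ^ card H"
    "\<And>n h. h \<in> H \<Longrightarrow> h ` P n \<subseteq> P (Suc n)"
    by auto
  define Q where "Q n = (\<Union>i\<le>n. (h ^^ i) ` P n)" for n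
  have comm: "h' ((h ^^ i) x) = (h ^^ i) (h' x)" if "h' \<in> insert h H" for h' i x
    using insert.prems(1)[OF that insertI1] by (induction i) simp_all
  have D: "(h ^^ i) x \<in> D" if "x \<in> D" for i x
    using insert.prems(2)[of h] that by (induction i) auto
  show ?case
  proof (intro exI[of _ Q] allI conjI ballI)
    fix n
    show "finite (Q n)" "Q n \<noteq> {}" using P(1,2) by (auto simp: Q_def)
    show "Q n \<subseteq> D" using P(3) D by (auto simp: Q_def)
    show "Q n \<subseteq> Q (Suc n)"
      using P(4)[of n] unfolding Q_def by (intro UN_mono image_mono) auto
    have "card (Q n) \<le> (\<Sum>i\<le>n. card ((h ^^ i) ` P n))"
      unfolding Q_def by (rule card_UN_le) simp
    also have "\<dots> \<le> (\<Sum>i\<le>n. Suc n ^ card H)"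
      by (intro sum_mono order_trans[OF card_image_le[OF P(1)] P(5)])
    also have "\<dots> = Suc n ^ card (insert h H)"
      using insert.hyps by simp
    finally show "card (Q n) \<le> Suc n ^ card (insert h H)" .
    fix h' assume h': "h' \<in> insert h H"
    show "h' ` Q n \<subseteq> Q (Suc n)"
    proof
      fix y assume "y \<in> h' ` Q n"
      then obtain i x where i: "i \<le> n" "x \<in> P n" "y = h' ((h ^^ i) x)" by (auto simp: Q_def)
      show "y \<in> Q (Suc n)"
      proof (cases "h' = h")
        case True
        then have "y = (h ^^ Suc i) x" "x \<in> P (Suc n)" "Suc i \<le> Suc n"
          using i P(4) by auto
        then show ?thesis unfolding Q_def by blast
      next
        case False
        then have "y = (h ^^ i) (h' x)" "h' x \<in> P (Suc n)"
          using i P(6)[of h' n] comm[OF h'] h' by auto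
        then show ?thesis unfolding Q_def using i(1) by (meson UN_I atMost_iff imageI le_SucI)
      qed
    qed
  qed
qed

lemma folner_commuting_maps:
  fixes \<epsilon> :: real
  assumes H: "finite H" "\<And>h h' x. h \<in> H \<Longrightarrow> h' \<in> H \<Longrightarrow> h (h' x) = h' (h x)"
    and D: "x0 \<in> D" "\<And>h. h \<in> H \<Longrightarrow> h ` D \<subseteq> D"
    and inj: "\<And>h. h \<in> H \<Longrightarrow> inj h" and \<epsilon>: "\<epsilon> > 0"
  obtains P where "finite P" "P \<noteq> {}" "P \<subseteq> D"
    "\<And>h. h \<in> H \<Longrightarrow> (1 - \<epsilon>) * real (card P) \<le> real (card (P \<inter> h ` P))"
proof -
  have "\<exists>P :: nat \<Rightarrow> 'a set. \<forall>n. finite (P n) \<and> P n \<noteq> {} \<and> P n \<subseteq> D \<and> P n \<subseteq> P (Suc n) \<and>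
           card (P n) \<le> Suc n ^ card H \<and> (\<forall>h\<in>H. h ` P n \<subseteq> P (Suc n))"
    by (rule polynomial_growth_commuting_maps[of H x0]; fact H D)
  then obtain P where "\<forall>n. finite (P n) \<and> P n \<noteq> {} \<and> P n \<subseteq> D \<and> P n \<subseteq> P (Suc n) \<and>
           card (P n) \<le> Suc n ^ card H \<and> (\<forall>h\<in>H. h ` P n \<subseteq> P (Suc n))" ..
  then have P:  "\<And>n. finite (P n)" "\<And>n. P n \<noteq> {}" "\<And>n. P n \<subseteq> D"
    "\<And>n. P n \<subseteq> P (Suc n)" "\<And>n. card (P n) \<le> Suc n ^ card H"
    "\<And>n h. h \<in> H \<Longrightarrow> h ` P n \<subseteq> P (Suc n)"
    by auto
  have "\<exists>n. real (card (P (Suc n))) \<le> (1 + \<epsilon>) * real (card (P n))"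
  proof (rule ccontr)
    assume "\<not> ?thesis"
    then have step: "(1 + \<epsilon>) * real (card (P n)) \<le> real (card (P (Suc n)))" for n
      by (meson linear)
    have "(1 + \<epsilon>) ^ n \<le> real (card (P n))" for n
    proof (induction n)
      case 0
      show ?case using P(1,2)[of 0] by (simp add: Suc_leI card_gt_0_iff)
    next
      case (Suc n)
      have "(1 + \<epsilon>) ^ Suc n \<le> (1 + \<epsilon>) * real (card (P n))" using Suc \<epsilon> by simp
      then show ?case using step[of n] by linarith
    qed
    also have "real (card (P n)) \<le> real (Suc n) ^ card H" for n
      using P(5)[of n] by (metis of_nat_le_iff of_nat_power)
    finally have "(1 + \<epsilon>) ^ n \<le> real (Suc n) ^ card H" for n .
    moreover have "(\<lambda>n. real (Suc n) ^ card H / (1 + \<epsilon>) ^ n) \<longlonglongrightarrow> 0"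
      using \<epsilon> by real_asymp
    then have "\<forall>\<^sub>F n in sequentially. real (Suc n) ^ card H / (1 + \<epsilon>) ^ n < 1"
      by (rule order_tendstoD) simp
    then obtain n where "real (Suc n) ^ card H / (1 + \<epsilon>) ^ n < 1"
      by (auto simp: eventually_sequentially)
    then have "real (Suc n) ^ card H < (1 + \<epsilon>) ^ n"
      using \<epsilon> by (simp add: field_simps)
    ultimately show False by (meson not_le)
  qed
  then obtain n where n: "real (card (P (Suc n))) \<le> (1 + \<epsilon>) * real (card (P n))" ..
  show thesis
  proof (rule that[of "P n"])
    fix h assume h: "h \<in> H"
    have "card (h ` P n) = card (P n)"
      using inj[OF h] by (metis card_image inj_on_subset subset_UNIV)
    moreover have "card (P n \<union> h ` P n) \<le> card (P (Suc n))"
      using P(1,4) P(6)[OF h] by (intro card_mono) auto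
    moreover have "card (P n) + card (h ` P n) = card (P n \<union> h ` P n) + card (P n \<inter> h ` P n)"
      using P(1) by (intro card_Un_Int) auto
    ultimately have "2 * real (card (P n)) \<le> real (card (P (Suc n))) + real (card (P n \<inter> h ` P n))"
      by linarith
    then show "(1 - \<epsilon>) * real (card (P n)) \<le> real (card (P n \<inter> h ` P n))"
      using n by (simp add: algebra_simps)
  qed (use P in auto)
qed

text \<open>Non-syndeticity is applied to all \<open>g\<close> precomposed with the translations by
  \<open>t \<in> B\<close>. A single \<open>x\<close> then serves every \<open>t\<close>, and as
  \<open>B\<close> has more elements than \<open>Z\<close>, some \<open>x + t\<close> falls outside
  \<open>Z\<close>.\<close>

lemma not_affinely_syndetic_avoiding:
  fixes S :: "'k::field set"
  assumes "infinite (UNIV :: 'k set)" "\<not> affinely_syndetic S" "finite G" "G \<subseteq> affine_group" "finite Z"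
  obtains x where "x \<notin> Z" "\<And>g. g \<in> G \<Longrightarrow> g x \<notin> S"
proof -
  obtain B :: "'k set" where B: "finite B" "card B = Suc (card Z)"
    using assms(1) infinite_arbitrarily_large by blast
  define G' where "G' = (\<lambda>(g, t). g \<circ> (\<lambda>x. x + t)) ` (G \<times> B)"
  have "finite G'" using assms(3) B(1) by (simp add: G'_def)
  moreover have "G' \<subseteq> affine_group"
  proof
    fix g' assume "g' \<in> G'"
    then obtain g t where g: "g \<in> G" "g' = g \<circ> (\<lambda>x. x + t)" by (auto simp: G'_def)
    then have "g \<in> affine_group" using assms(4) by blast
    then obtain v w where "v \<noteq> 0" "g = (\<lambda>x. v * x + w)" by (auto simp: affine_group_def)
    with g have "v \<noteq> 0 \<and> g' = (\<lambda>x. v * x + (v * t + w))" by (auto simp: algebra_simps)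
    then show "g' \<in> affine_group" unfolding affine_group_def by blast
  qed
  ultimately have "\<exists>x. \<forall>g'\<in>G'. g' x \<notin> S"
    using assms(2) unfolding affinely_syndetic_def by metis
  then obtain x where x: "\<And>g'. g' \<in> G' \<Longrightarrow> g' x \<notin> S" by blast
  have "\<not> (\<lambda>t. x + t) ` B \<subseteq> Z"
  proof
    assume "(\<lambda>t. x + t) ` B \<subseteq> Z"
    then have "card B \<le> card Z" using assms(5) card_inj_on_le[of "\<lambda>t. x + t" B Z] by simp
    then show False using B(2) by simp
  qed
  then obtain t where "t \<in> B" "x + t \<notin> Z" by auto
  moreover have "g (x + t) \<notin> S" if "g \<in> G" for g
  proof -
    have "g \<circ> (\<lambda>x. x + t) \<in> G'"
      unfolding G'_def using that \<open>t \<in> B\<close> by (intro image_eqI[of _ _ "(g, t)"]) auto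
    then show ?thesis using x by fastforce
  qed
  ultimately show thesis by (intro that)
qed

lemma finite_double_folner_avoiding:
  fixes S :: "'k::field set" and \<epsilon> :: real
  assumes inf: "infinite (UNIV :: 'k set)" and S: "\<not> affinely_syndetic S"
    and U: "finite U" "0 \<notin> U" and \<epsilon>: "\<epsilon> > 0"
  obtains F where "finite F" "F \<noteq> {}" "F \<inter> S = {}" "0 \<notin> F"
    "\<And>u. u \<in> U \<Longrightarrow> (1 - \<epsilon>) * real (card F) \<le> real (card (F \<inter> (\<lambda>x. x + u) ` F))"
    "\<And>u. u \<in> U \<Longrightarrow> (1 - \<epsilon>) * real (card F) \<le> real (card (F \<inter> (\<lambda>x. x * u) ` F))"
proof -
  obtain V where V: "finite V" "V \<noteq> {}" "V \<subseteq> - {0}"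
    "\<And>h. h \<in> (\<lambda>u x. x * u) ` U \<Longrightarrow> (1 - \<epsilon>) * real (card V) \<le> real (card (V \<inter> h ` V))"
  proof (rule folner_commuting_maps[of "(\<lambda>u x. x * u) ` U" 1 "- {0}" \<epsilon>])
    fix h assume h: "h \<in> (\<lambda>u x. x * u) ` U"
    then show "h ` (- {0}) \<subseteq> - {0}" "inj h" using U(2) by (auto simp: inj_def)
    show "h (h' x) = h' (h x)" if "h' \<in> (\<lambda>u x. x * u) ` U" for h' x
      using h that by (auto simp: mult_ac)
  next
    fix P assume P: "finite P" "P \<noteq> {}" "P \<subseteq> - {0 :: 'k}"
      "\<And>h. h \<in> (\<lambda>u x. x * u) ` U \<Longrightarrow> (1 - \<epsilon>) * real (card P) \<le> real (card (P \<inter> h ` P))"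
    show ?thesis by (rule that; fact P)
  qed (use U(1) \<epsilon> in simp_all)
  obtain W where W: "finite W" "W \<noteq> {}"
    "\<And>h. h \<in> (\<lambda>(u, v) x. x + u / v) ` (U \<times> V) \<Longrightarrow> (1 - \<epsilon>) * real (card W) \<le> real (card (W \<inter> h ` W))"
  proof (rule folner_commuting_maps[of "(\<lambda>(u, v) x. x + u / v) ` (U \<times> V)" 0 UNIV \<epsilon>])
    fix h assume h: "h \<in> (\<lambda>(u, v) x. x + u / v) ` (U \<times> V)"
    then show "inj h" by (auto simp: inj_def)
    show "h (h' x) = h' (h x)" if "h' \<in> (\<lambda>(u, v) x. x + u / v) ` (U \<times> V)" for h' x
      using h that by (auto simp: add_ac)
  next
    fix P assume P: "finite P" "P \<noteq> {}"
      "\<And>h. h \<in> (\<lambda>(u, v) x. x + u / v) ` (U \<times> V) \<Longrightarrow> (1 - \<epsilon>) * real (card P) \<le> real (card (P \<inter> h ` P))"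
    show ?thesis by (rule that; fact P)
  qed (use U(1) V(1) \<epsilon> in simp_all)
  \<comment> \<open>The values of \<open>x\<close> to avoid: those for which
    \<open>v * (x + w) = v' * (x + w')\<close> with distinct \<open>v\<close>, \<open>v'\<close>,
    which would spoil injectivity of the parametrization \<open>e\<close>, and those for which some
    \<open>x + w\<close> is zero. Pairs with \<open>v = v'\<close> only add the harmless value
    \<open>0\<close>, by division by zero.\<close>
  define Z where "Z = (\<lambda>((v, w), (v', w')). (v' * w' - v * w) / (v - v')) ` ((V \<times> W) \<times> (V \<times> W)) \<union> uminus ` W"
  have "finite Z" using V(1) W(1) by (simp add: Z_def)
  define G where "G = (\<lambda>(v, w) x. v * (x + w)) ` (V \<times> W)"
  have "finite G" using V(1) W(1) by (simp add: G_def)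
  have "G \<subseteq> affine_group"
  proof
    fix g assume "g \<in> G"
    then obtain v w where "v \<in> V" "g = (\<lambda>x. v * (x + w))" by (auto simp: G_def)
    then have "v \<noteq> 0" "g = (\<lambda>x. v * x + v * w)" using V(3) by (auto simp: distrib_left)
    then show "g \<in> affine_group" by (auto simp: affine_group_def)
  qed
  with not_affinely_syndetic_avoiding[OF inf S \<open>finite G\<close> _ \<open>finite Z\<close>]
  obtain x where x: "x \<notin> Z" "\<And>g. g \<in> G \<Longrightarrow> g x \<notin> S" by blast
  define e where "e = (\<lambda>(v, w). v * (x + w))"
  define F where "F = e ` (V \<times> W)"
  have inj: "inj_on e (V \<times> W)"
  proof (intro inj_onI, clarify)
    fix v w v' w' assume *: "v \<in> V" "w \<in> W" "v' \<in> V" "w' \<in> W" "e (v, w) = e (v', w')"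
    then have eq: "x * (v - v') = v' * w' - v * w" by (simp add: e_def algebra_simps)
    have "v = v'"
    proof (rule ccontr)
      assume "v \<noteq> v'"
      then have "x = (v' * w' - v * w) / (v - v')" using eq by (simp add: eq_divide_eq)
      then have "x = (\<lambda>((v, w), (v', w')). (v' * w' - v * w) / (v - v')) ((v, w), (v', w'))" by simp
      then have "x \<in> Z" unfolding Z_def using *(1-4) by blast
      with x(1) show False ..
    qed
    with * V(3) show "v = v' \<and> w = w'" by (auto simp: e_def)
  qed
  have card_F: "card F = card V * card W"
    unfolding F_def using inj by (simp add: card_image card_cartesian_product)
  \<comment> \<open>By injectivity of \<open>e\<close>, overlaps can be counted in the parameter set
    \<open>V \<times> W\<close>.\<close>
  have lower: "real (card Q) \<le> real (card (F \<inter> E))" if "Q \<subseteq> V \<times> W" "e ` Q \<subseteq> E" for Q E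
  proof -
    have "card Q = card (e ` Q)" using inj that(1) by (metis card_image inj_on_subset)
    also have "\<dots> \<le> card (F \<inter> E)"
      using that V(1) W(1) by (intro card_mono) (auto simp: F_def)
    finally show ?thesis by simp
  qed
  show thesis
  proof (rule that[of F])
    show "finite F" "F \<noteq> {}" using V W by (auto simp: F_def)
    show "F \<inter> S = {}" using x(2) by (fastforce simp: F_def G_def e_def)
    show "0 \<notin> F"
    proof
      assume "0 \<in> F"
      then obtain w where "w \<in> W" "x + w = 0" using V(3) by (auto simp: F_def e_def)
      then have "x = - w" by (simp add: eq_neg_iff_add_eq_0)
      then show False using x(1) \<open>w \<in> W\<close> by (simp add: Z_def)
    qed
    fix u assume u: "u \<in> U"
    show "(1 - \<epsilon>) * real (card F) \<le> real (card (F \<inter> (\<lambda>x. x + u) ` F))"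
    proof -
      \<comment> \<open>Adding \<open>u\<close> to \<open>v * (x + w)\<close> changes only the
        second parameter, by \<open>u / v\<close>. Hence the almost invariance of \<open>W\<close>
        is used separately over each \<open>v\<close>.\<close>
      let ?Q = "SIGMA v:V. W \<inter> (\<lambda>x. x + u / v) ` W"
      have "(1 - \<epsilon>) * real (card F) = (\<Sum>v\<in>V. (1 - \<epsilon>) * real (card W))"
        by (simp add: card_F)
      also have "\<dots> \<le> (\<Sum>v\<in>V. real (card (W \<inter> (\<lambda>x. x + u / v) ` W)))"
        using u by (intro sum_mono W(3)) auto
      also have "\<dots> = real (card ?Q)" using V(1) W(1) by simp
      also have "\<dots> \<le> real (card (F \<inter> (\<lambda>x. x + u) ` F))"
      proof (rule lower)
        show "e ` ?Q \<subseteq> (\<lambda>x. x + u) ` F"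
        proof clarify
          fix v w w' assume "v \<in> V" "w' \<in> W"
          moreover from this have "e (v, w' + u / v) = e (v, w') + u"
            using V(3) by (auto simp: e_def field_simps)
          ultimately show "e (v, w' + u / v) \<in> (\<lambda>x. x + u) ` F" by (auto simp: F_def)
        qed
      qed auto
      finally show ?thesis .
    qed
    show "(1 - \<epsilon>) * real (card F) \<le> real (card (F \<inter> (\<lambda>x. x * u) ` F))"
    proof -
      \<comment> \<open>Multiplying \<open>v * (x + w)\<close> by \<open>u\<close> changes only the
        first parameter, so almost invariance of \<open>V\<close> suffices.\<close>
      let ?Q = "(V \<inter> (\<lambda>x. x * u) ` V) \<times> W"
      have "(1 - \<epsilon>) * real (card F) = ((1 - \<epsilon>) * real (card V)) * real (card W)"
        by (simp add: card_F)
      also have "\<dots> \<le> real (card (V \<inter> (\<lambda>x. x * u) ` V)) * real (card W)"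
        using u by (intro mult_right_mono V(4)) auto
      also have "\<dots> = real (card ?Q)" by (simp add: card_cartesian_product)
      also have "\<dots> \<le> real (card (F \<inter> (\<lambda>x. x * u) ` F))"
      proof (rule lower)
        show "e ` ?Q \<subseteq> (\<lambda>x. x * u) ` F"
        proof clarify
          fix v' w assume "v' \<in> V" "w \<in> W"
          moreover have "e (v' * u, w) = e (v', w) * u" by (simp add: e_def)
          ultimately show "e (v' * u, w) \<in> (\<lambda>x. x * u) ` F" by (auto simp: F_def)
        qed
      qed auto
      finally show ?thesis .
    qed
  qed
qed

lemma double_folner_avoiding:
  fixes S :: "'k::field set"
  assumes cnt: "countable (UNIV :: 'k set)" and inf: "infinite (UNIV :: 'k set)"
    and S: "\<not> affinely_syndetic S"
  obtains F where "double_folner F" "\<And>N. F N \<inter> S = {}" "\<And>N. 0 \<notin> F N"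
proof -
  \<comment> \<open>The finite sets \<open>U N\<close> increase to the set of all nonzero elements.
    A fixed \<open>u\<close> is thus among the prescribed shifts from some \<open>N\<close> on, with
    error \<open>1 / Suc N\<close> tending to zero.\<close>
  define U where "U N = from_nat_into (UNIV :: 'k set) ` {..N} - {0}" for N :: nat
  define good where "good N F \<longleftrightarrow> finite F \<and> F \<noteq> {} \<and> F \<inter> S = {} \<and> 0 \<notin> F \<and> (\<forall>u\<in>U N.
      (1 - 1 / real (Suc N)) * real (card F) \<le> real (card (F \<inter> (\<lambda>x. x + u) ` F)) \<and>
      (1 - 1 / real (Suc N)) * real (card F) \<le> real (card (F \<inter> (\<lambda>x. x * u) ` F)))" for N F
  have "\<exists>F. good N F" for N
  proof (rule finite_double_folner_avoiding[OF inf S, of "U N" "1 / real (Suc N)"])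
    show "finite (U N)" "0 \<notin> U N" by (auto simp: U_def)
  qed (auto simp: good_def)
  then obtain F where F: "\<And>N. good N (F N)" by metis
  have ratio: "(\<lambda>N. real (card (F N \<inter> B N)) / real (card (F N))) \<longlonglongrightarrow> 1"
    if "\<forall>\<^sub>F N in sequentially. (1 - 1 / real (Suc N)) * real (card (F N)) \<le> real (card (F N \<inter> B N))" for B
  proof (rule tendsto_sandwich)
    have pos: "real (card (F N)) > 0" for N
      using F[of N] by (simp add: good_def card_gt_0_iff)
    show "\<forall>\<^sub>F N in sequentially. 1 - 1 / real (Suc N) \<le> real (card (F N \<inter> B N)) / real (card (F N))"
      using that by eventually_elim (use pos in \<open>simp add: pos_le_divide_eq\<close>)
    have "card (F N \<inter> B N) \<le> card (F N)" for N
      using F[of N] by (intro card_mono) (auto simp: good_def)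
    then show "\<forall>\<^sub>F N in sequentially. real (card (F N \<inter> B N)) / real (card (F N)) \<le> 1"
      using pos by (intro always_eventually) (simp add: pos_divide_le_eq)
    show "(\<lambda>N. 1 - 1 / real (Suc N)) \<longlonglongrightarrow> 1" by real_asymp
  qed simp
  have ev: "\<forall>\<^sub>F N in sequentially. u \<in> U N" if "u \<noteq> 0" for u
  proof -
    obtain m where "from_nat_into (UNIV :: 'k set) m = u"
      using cnt by (metis UNIV_I from_nat_into_surj)
    then have "u \<in> U N" if "N \<ge> m" for N using that \<open>u \<noteq> 0\<close> by (auto simp: U_def)
    then show ?thesis by (auto simp: eventually_sequentially)
  qed
  have "double_folner F"
    unfolding double_folner_def
  proof (intro conjI allI impI)
    fix N show "finite (F N)" "F N \<noteq> {}" using F[of N] by (auto simp: good_def)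
  next
    fix u :: 'k assume "u \<noteq> 0"
    note e = ev[OF this]
    show "(\<lambda>N. real (card (F N \<inter> (\<lambda>x. x + u) ` F N)) / real (card (F N))) \<longlonglongrightarrow> 1"
      by (rule ratio, rule eventually_mono[OF e]) (use F in \<open>auto simp: good_def\<close>)
    show "(\<lambda>N. real (card (F N \<inter> (\<lambda>x. x * u) ` F N)) / real (card (F N))) \<longlonglongrightarrow> 1"
      by (rule ratio, rule eventually_mono[OF e]) (use F in \<open>auto simp: good_def\<close>)
  qed
  with F show thesis by (intro that) (auto simp: good_def)
qed

lemma affinely_syndetic_iff_upper_density_pos:
  fixes S :: "'k::field set"
  assumes "countable (UNIV :: 'k set)" "infinite (UNIV :: 'k set)"
  shows "affinely_syndetic S \<longleftrightarrow> (\<forall>F. double_folner F \<longrightarrow> upper_density F S > 0)"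
proof (intro iffI allI impI)
  assume pos: "\<forall>F. double_folner F \<longrightarrow> upper_density F S > 0"
  show "affinely_syndetic S"
  proof (rule ccontr)
    assume "\<not> affinely_syndetic S"
    then obtain F where F: "double_folner F" "\<And>N. F N \<inter> S = {}" "\<And>N. 0 \<notin> F N"
      using double_folner_avoiding[OF assms] by metis
    then have "upper_density F S = 0"
      by (simp add: upper_density_def Int_commute[of S] Limsup_const flip: zero_ereal_def)
    then show False using pos F(1) by force
  qed
qed (rule affinely_syndetic_imp_upper_density_pos)

section \<open>Semi-inner products\<close>

lemma finite_square_roots: "finite {x :: 'k::field. x\<^sup>2 = y}"
proof (cases "\<exists>x. x\<^sup>2 = y")
  case True
  then obtain x where "x\<^sup>2 = y" ..
  then have "{x. x\<^sup>2 = y} \<subseteq> {x, - x}" by (auto simp: power2_eq_iff)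
  then show ?thesis by (rule finite_subset) simp
qed simp

text \<open>Squaring has finite fibres, so an infinite field has infinitely many squares, and one
  root is chosen for each of \<open>n\<close> nonzero ones. In van der Corput's trick this makes
  \<open>b - b'\<^sup>2 / b\<close> nonzero for distinct \<open>b\<close>, \<open>b'\<close>, also
  in characteristic two and for fields containing \<open>- b\<close> with \<open>b\<close>.\<close>

lemma obtain_distinct_squares:
  assumes "infinite (UNIV :: 'k::field set)"
  obtains D :: "'k::field set" where "finite D" "card D = n" "0 \<notin> D" "inj_on (\<lambda>x. x\<^sup>2) D"
proof -
  define sq where "sq = (\<lambda>x::'k. x\<^sup>2)"
  have "infinite (range sq)"
  proof
    assume "finite (range sq)"
    moreover have "(\<Union>y\<in>range sq. {x. x\<^sup>2 = y}) = UNIV" by (auto simp: sq_def)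
    ultimately show False using assms finite_square_roots by (metis finite_UN)
  qed
  then obtain Y where Y: "finite Y" "card Y = n" "Y \<subseteq> range sq - {0}"
    using infinite_arbitrarily_large[of "range sq - {0}" n] by (auto simp: infinite_remove)
  have sq_inv: "sq (inv sq y) = y" if "y \<in> Y" for y
    using Y(3) that by (auto simp: f_inv_into_f)
  have "inj_on (inv sq) Y" by (rule inj_on_inverseI[of _ sq]) (rule sq_inv)
  moreover have "inj_on sq (inv sq ` Y)" by (auto simp: inj_on_def sq_inv)
  moreover have "0 \<notin> inv sq ` Y"
  proof
    assume "0 \<in> inv sq ` Y"
    then obtain y where "y \<in> Y" "inv sq y = 0" by auto
    then have "y = 0" using sq_inv[of y] by (simp add: sq_def)
    with \<open>y \<in> Y\<close> Y(3) show False by blast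
  qed
  ultimately show thesis
    using Y by (intro that[of "inv sq ` Y"]) (auto simp: card_image sq_def)
qed

text \<open>Only semidefiniteness is asked for, since functions vanishing almost everywhere have
  norm zero, and \<open>V\<close> is a subset so that it can be the bounded functions. Completeness
  is absent, which is why elements of almost minimal norm stand in for projections.\<close>

locale semi_inner_product =
  fixes V :: "'v::real_vector set" and ip :: "'v \<Rightarrow> 'v \<Rightarrow> real"
  assumes subspace_V: "subspace V"
    and ip_add_left: "x \<in> V \<Longrightarrow> y \<in> V \<Longrightarrow> z \<in> V \<Longrightarrow> ip (x + y) z = ip x z + ip y z"
    and ip_scaleR_left: "x \<in> V \<Longrightarrow> z \<in> V \<Longrightarrow> ip (c *\<^sub>R x) z = c * ip x z"
    and ip_commute: "x \<in> V \<Longrightarrow> y \<in> V \<Longrightarrow> ip x y = ip y x"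
    and ip_self_nonneg: "x \<in> V \<Longrightarrow> 0 \<le> ip x x"
begin

lemmas V_closed [simp] = subspace_add[OF subspace_V] subspace_diff[OF subspace_V]
  subspace_scale[OF subspace_V] subspace_0[OF subspace_V]

lemma sum_V [simp]: "(\<And>i. i \<in> I \<Longrightarrow> x i \<in> V) \<Longrightarrow> sum x I \<in> V"
  by (rule subspace_sum[OF subspace_V])

lemma ip_add_right: "x \<in> V \<Longrightarrow> y \<in> V \<Longrightarrow> z \<in> V \<Longrightarrow> ip z (x + y) = ip z x + ip z y"
  by (simp add: ip_commute[of z] ip_add_left)

lemma ip_scaleR_right: "x \<in> V \<Longrightarrow> z \<in> V \<Longrightarrow> ip z (c *\<^sub>R x) = c * ip z x"
  by (simp add: ip_commute[of z] ip_scaleR_left)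

lemma ip_diff_left: "x \<in> V \<Longrightarrow> y \<in> V \<Longrightarrow> z \<in> V \<Longrightarrow> ip (x - y) z = ip x z - ip y z"
  using ip_add_left[of x "(-1) *\<^sub>R y" z] by (simp add: ip_scaleR_left del: scaleR_minus_left scaleR_minus1_left) simp

lemma ip_diff_right: "x \<in> V \<Longrightarrow> y \<in> V \<Longrightarrow> z \<in> V \<Longrightarrow> ip z (x - y) = ip z x - ip z y"
  by (simp add: ip_commute[of z] ip_diff_left)

lemmas ip_simps = ip_add_left ip_add_right ip_diff_left ip_diff_right ip_scaleR_left ip_scaleR_right

lemma ip_zero_left [simp]: "z \<in> V \<Longrightarrow> ip 0 z = 0"
  using ip_scaleR_left[of 0 z 0] by simp

lemma ip_sum_left:
  assumes "\<And>i. i \<in> I \<Longrightarrow> x i \<in> V" "z \<in> V"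
  shows "ip (sum x I) z = (\<Sum>i\<in>I. ip (x i) z)"
  using assms by (induction I rule: infinite_finite_induct) (auto simp: ip_add_left)

lemma ip_sum_right:
  assumes "\<And>i. i \<in> I \<Longrightarrow> x i \<in> V" "z \<in> V"
  shows "ip z (sum x I) = (\<Sum>i\<in>I. ip z (x i))"
  using assms by (simp add: ip_commute[of z] ip_sum_left)

lemma ip_Cauchy_Schwarz:
  assumes [simp]: "x \<in> V" "y \<in> V"
  shows "(ip x y)\<^sup>2 \<le> ip x x * ip y y"
proof (cases "ip y y = 0")
  case True
  have *: "0 \<le> ip x x + 2 * t * ip x y" for t
    using ip_self_nonneg[of "x + t *\<^sub>R y"] True
    by (simp add: ip_simps ip_commute[of y x])
  \<comment> \<open>An affine function of \<open>t\<close> that is never negative has slope zero: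
    the chosen \<open>t\<close> would give it the value \<open>-1\<close>.\<close>
  have "ip x y = 0"
    using *[of "- (ip x x + 1) / (2 * ip x y)"] by (cases "ip x y = 0") (auto simp: field_simps)
  then show ?thesis by (simp add: True)
next
  case False
  then have pos: "ip y y > 0" using ip_self_nonneg[of y] by simp
  \<comment> \<open>The vector is \<open>ip y y\<close> times the component of \<open>x\<close>
    orthogonal to \<open>y\<close>.\<close>
  have "0 \<le> ip (ip y y *\<^sub>R x - ip x y *\<^sub>R y) (ip y y *\<^sub>R x - ip x y *\<^sub>R y)"
    by (rule ip_self_nonneg) simp
  also have "\<dots> = ip y y * (ip x x * ip y y - (ip x y)\<^sup>2)"
    by (simp add: ip_simps ip_commute[of y x] power2_eq_square algebra_simps)
  finally show ?thesis using pos by (simp add: zero_le_mult_iff)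
qed

definition nrm :: "'v \<Rightarrow> real" where "nrm x = sqrt (ip x x)"

lemma nrm_nonneg [simp]: "x \<in> V \<Longrightarrow> 0 \<le> nrm x"
  by (simp add: nrm_def ip_self_nonneg)

lemma nrm_square: "x \<in> V \<Longrightarrow> (nrm x)\<^sup>2 = ip x x"
  by (simp add: nrm_def ip_self_nonneg)

lemma abs_ip_le: "x \<in> V \<Longrightarrow> y \<in> V \<Longrightarrow> \<bar>ip x y\<bar> \<le> nrm x * nrm y"
  using ip_Cauchy_Schwarz[of x y] real_sqrt_le_mono[of "(ip x y)\<^sup>2" "ip x x * ip y y"]
  by (simp add: nrm_def real_sqrt_mult)

lemma nrm_triangle:
  assumes [simp]: "x \<in> V" "y \<in> V"
  shows "nrm (x + y) \<le> nrm x + nrm y"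
proof (rule power2_le_imp_le)
  show "(nrm (x + y))\<^sup>2 \<le> (nrm x + nrm y)\<^sup>2"
    using abs_ip_le[of x y] by (simp add: nrm_square power2_sum ip_simps ip_commute[of y x])
qed simp

lemma nrm_scaleR: "x \<in> V \<Longrightarrow> nrm (c *\<^sub>R x) = \<bar>c\<bar> * nrm x"
  by (simp add: nrm_def ip_simps real_sqrt_mult flip: mult.assoc power2_eq_square)

text \<open>An element of almost minimal norm in a midpoint-convex set is almost fixed by all
  norm-preserving self-maps of the set, by the parallelogram identity.\<close>

lemma almost_fixed_point:
  assumes C: "C \<subseteq> V" "c0 \<in> C" and mid: "\<And>x y. x \<in> C \<Longrightarrow> y \<in> C \<Longrightarrow> (1/2) *\<^sub>R (x + y) \<in> C"
    and s: "\<And>i x. i \<in> I \<Longrightarrow> x \<in> C \<Longrightarrow> s i x \<in> C" "\<And>i x. i \<in> I \<Longrightarrow> x \<in> C \<Longrightarrow> ip (s i x) (s i x) = ip x x"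
    and \<epsilon>: "\<epsilon> > 0"
  obtains c where "c \<in> C" "\<And>i. i \<in> I \<Longrightarrow> nrm (s i c - c) \<le> \<epsilon>"
proof -
  define d where "d = (INF x\<in>C. ip x x)"
  have bdd: "bdd_below ((\<lambda>x. ip x x) ` C)"
    using C(1) ip_self_nonneg by (intro bdd_belowI[of _ 0]) auto
  \<comment> \<open>The quarter comes from the parallelogram identity: the squared displacement of
    \<open>c\<close> is four times the gap between \<open>ip c c\<close> and the squared norm of the
    midpoint, which is at least \<open>d\<close>.\<close>
  have "\<exists>c\<in>C. ip c c < d + \<epsilon>\<^sup>2 / 4"
  proof (rule ccontr)
    assume "\<not> ?thesis"
    then have "d + \<epsilon>\<^sup>2 / 4 \<le> d" unfolding d_def using C(2) by (intro cINF_greatest) (auto simp: not_less)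
    with \<epsilon> show False by simp
  qed
  then obtain c where c: "c \<in> C" "ip c c < d + \<epsilon>\<^sup>2 / 4" ..
  show thesis
  proof (rule that[OF c(1)])
    fix i assume i: "i \<in> I"
    let ?s = "s i c"
    have V: "c \<in> V" "?s \<in> V" using C(1) c(1) s(1)[OF i] by auto
    have "d \<le> ip ((1/2) *\<^sub>R (?s + c)) ((1/2) *\<^sub>R (?s + c))"
      unfolding d_def using mid s(1)[OF i] c(1) by (intro cINF_lower[OF bdd]) auto
    also have "\<dots> = (ip c c + ip ?s c) / 2"
      using V s(2)[OF i c(1)] by (simp add: ip_simps ip_commute[of c ?s] field_simps)
    finally have "2 * ip c c - 2 * ip ?s c \<le> \<epsilon>\<^sup>2"
      using c(2) by (simp add: field_simps)
    also have "2 * ip c c - 2 * ip ?s c = (nrm (?s - c))\<^sup>2"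
      using V s(2)[OF i c(1)] by (simp add: nrm_square ip_simps ip_commute[of c ?s])
    finally have "(nrm (?s - c))\<^sup>2 \<le> \<epsilon>\<^sup>2" .
    then show "nrm (?s - c) \<le> \<epsilon>" by (rule power2_le_imp_le) (use \<epsilon> in simp)
  qed
qed

end

section \<open>Isometric representations of the affine group\<close>

text \<open>The Koopman representation of the affine group, given by its restrictions \<open>\<tau>\<close> to translations
  and \<open>\<sigma>\<close> to dilations. As composition with a map reverses products, \<open>\<tau> w \<circ> \<sigma> v\<close> represents
  \<open>M\<^sub>v \<circ> A\<^sub>w = A\<^sub>v\<^sub>w \<circ> M\<^sub>v\<close>.\<close>

locale affine_isometries = semi_inner_product V ip
  for V :: "'v::real_vector set" and ip +
  fixes \<tau> \<sigma> :: "'k::field \<Rightarrow> 'v \<Rightarrow> 'v"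
  assumes \<tau>_V [simp]: "x \<in> V \<Longrightarrow> \<tau> w x \<in> V"
    and \<tau>_linear: "x \<in> V \<Longrightarrow> y \<in> V \<Longrightarrow> \<tau> w (x + y) = \<tau> w x + \<tau> w y"
      "x \<in> V \<Longrightarrow> \<tau> w (c *\<^sub>R x) = c *\<^sub>R \<tau> w x"
    and \<tau>_0 [simp]: "x \<in> V \<Longrightarrow> \<tau> 0 x = x"
    and \<tau>_\<tau>: "x \<in> V \<Longrightarrow> \<tau> w (\<tau> w' x) = \<tau> (w + w') x"
    and ip_\<tau>: "x \<in> V \<Longrightarrow> y \<in> V \<Longrightarrow> ip (\<tau> w x) (\<tau> w y) = ip x y"
    and \<sigma>_V [simp]: "v \<noteq> 0 \<Longrightarrow> x \<in> V \<Longrightarrow> \<sigma> v x \<in> V"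
    and \<sigma>_linear: "v \<noteq> 0 \<Longrightarrow> x \<in> V \<Longrightarrow> y \<in> V \<Longrightarrow> \<sigma> v (x + y) = \<sigma> v x + \<sigma> v y"
      "v \<noteq> 0 \<Longrightarrow> x \<in> V \<Longrightarrow> \<sigma> v (c *\<^sub>R x) = c *\<^sub>R \<sigma> v x"
    and \<sigma>_1 [simp]: "x \<in> V \<Longrightarrow> \<sigma> 1 x = x"
    and \<sigma>_\<sigma>: "v \<noteq> 0 \<Longrightarrow> v' \<noteq> 0 \<Longrightarrow> x \<in> V \<Longrightarrow> \<sigma> v (\<sigma> v' x) = \<sigma> (v * v') x"
    and ip_\<sigma>: "v \<noteq> 0 \<Longrightarrow> x \<in> V \<Longrightarrow> y \<in> V \<Longrightarrow> ip (\<sigma> v x) (\<sigma> v y) = ip x y"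
    and \<tau>_\<sigma>: "v \<noteq> 0 \<Longrightarrow> x \<in> V \<Longrightarrow> \<tau> w (\<sigma> v x) = \<sigma> v (\<tau> (v * w) x)"
begin

lemma \<tau>_diff: "x \<in> V \<Longrightarrow> y \<in> V \<Longrightarrow> \<tau> w (x - y) = \<tau> w x - \<tau> w y"
  using \<tau>_linear(1)[of "x - y" y w] by simp

lemma \<sigma>_diff: "v \<noteq> 0 \<Longrightarrow> x \<in> V \<Longrightarrow> y \<in> V \<Longrightarrow> \<sigma> v (x - y) = \<sigma> v x - \<sigma> v y"
  using \<sigma>_linear(1)[of v "x - y" y] by simp

lemma nrm_\<tau> [simp]: "x \<in> V \<Longrightarrow> nrm (\<tau> w x) = nrm x"
  by (simp add: nrm_def ip_\<tau>)

lemma nrm_\<sigma> [simp]: "v \<noteq> 0 \<Longrightarrow> x \<in> V \<Longrightarrow> nrm (\<sigma> v x) = nrm x"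
  by (simp add: nrm_def ip_\<sigma>)

lemma \<sigma>_\<tau>: "v \<noteq> 0 \<Longrightarrow> x \<in> V \<Longrightarrow> \<sigma> v (\<tau> w x) = \<tau> (w / v) (\<sigma> v x)"
  by (simp add: \<tau>_\<sigma>)

lemma ip_\<tau>_right: "x \<in> V \<Longrightarrow> y \<in> V \<Longrightarrow> ip x (\<tau> w y) = ip (\<tau> (- w) x) y"
  using ip_\<tau>[of "\<tau> (- w) x" y w] by (simp add: \<tau>_\<tau>)

lemma ip_\<sigma>_right: "v \<noteq> 0 \<Longrightarrow> x \<in> V \<Longrightarrow> y \<in> V \<Longrightarrow> ip x (\<sigma> v y) = ip (\<sigma> (inverse v) x) y"
  using ip_\<sigma>[of v "\<sigma> (inverse v) x" y] by (simp add: \<sigma>_\<sigma>)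

text \<open>Moving both operators to one side and commuting translations past dilations leaves a
  single translation whose parameter is linear in \<open>u\<close>, tested against a vector
  independent of \<open>u\<close>. Averages over \<open>u\<close> of such terms are covered by the
  hypothesis on \<open>h\<close> in \<open>van_der_Corput\<close>, provided \<open>b\<close> and
  \<open>b'\<close> have different squares.\<close>

lemma ip_twisted_orbit:
  assumes "u \<noteq> 0" "b \<noteq> 0" "b' \<noteq> 0" and [simp]: "h \<in> V"
  shows "ip (\<sigma> (inverse (u * b)) (\<tau> (u * b) h)) (\<sigma> (inverse (u * b')) (\<tau> (u * b') h))
           = ip (\<tau> (u * (b - b'\<^sup>2 / b)) h) (\<sigma> (b / b') h)"
proof -
  have "ip (\<sigma> (inverse (u * b)) (\<tau> (u * b) h)) (\<sigma> (inverse (u * b')) (\<tau> (u * b') h))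
      = ip (\<sigma> (u * b') (\<sigma> (inverse (u * b)) (\<tau> (u * b) h))) (\<tau> (u * b') h)"
    using assms by (simp add: ip_\<sigma>_right)
  also have "\<dots> = ip (\<sigma> (b' / b) (\<tau> (u * b) h)) (\<tau> (u * b') h)"
    using assms by (simp add: \<sigma>_\<sigma> field_simps)
  also have "\<dots> = ip (\<tau> (- (u * b')) (\<sigma> (b' / b) (\<tau> (u * b) h))) h"
    using assms by (simp add: ip_\<tau>_right)
  also have "\<dots> = ip (\<sigma> (b' / b) (\<tau> (b' / b * - (u * b') + u * b) h)) h"
    using assms by (simp add: \<tau>_\<sigma> \<tau>_\<tau>)
  also have "b' / b * - (u * b') + u * b = u * (b - b'\<^sup>2 / b)"
    using assms by (simp add: field_simps power2_eq_square)
  also have "ip (\<sigma> (b' / b) (\<tau> (u * (b - b'\<^sup>2 / b)) h)) h = ip (\<tau> (u * (b - b'\<^sup>2 / b)) h) (\<sigma> (b / b') h)"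
    using assms by (simp add: ip_\<sigma>_right[of "b / b'"])
  finally show ?thesis .
qed

text \<open>Van der Corput's trick for the multiplicative group: averaging over the dilates \<open>u * b\<close>,
  \<open>b \<in> D\<close>, leaves only the diagonal terms, since the off-diagonal correlations are averages
  along translations.\<close>

lemma van_der_Corput:
  fixes F :: "nat \<Rightarrow> 'k set"
  assumes inf: "infinite (UNIV :: 'k set)" and F: "double_folner F" "\<And>N. 0 \<notin> F N"
    and [simp]: "h \<in> V" "k \<in> V"
    and h: "\<And>k \<alpha>. k \<in> V \<Longrightarrow> \<alpha> \<noteq> 0 \<Longrightarrow> (\<lambda>N. avg (F N) (\<lambda>u. ip (\<tau> (u * \<alpha>) h) k)) \<longlonglongrightarrow> 0"
  shows "(\<lambda>N. avg (F N) (\<lambda>u. ip (\<sigma> (inverse u) (\<tau> u h)) k)) \<longlonglongrightarrow> 0"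
proof -
  note fin [simp] = double_folner_finite[OF F(1)] double_folner_nonempty[OF F(1)]
  define x where "x u = \<sigma> (inverse u) (\<tau> u h)" for u
  have x_V [simp]: "x u \<in> V" if "u \<noteq> 0" for u using that by (simp add: x_def)
  have F_nz: "u \<noteq> 0" if "u \<in> F N" for u N using F(2) that by metis
  define s where "s N = avg (F N) (\<lambda>u. ip (x u) k)" for N
  have "\<forall>\<^sub>F N in sequentially. \<bar>s N\<bar> < \<epsilon>" if \<epsilon>: "\<epsilon> > 0" for \<epsilon>
  proof -
    define c where "c = ip h h"
    have c: "c \<ge> 0" by (simp add: c_def ip_self_nonneg)
    define \<kappa> where "\<kappa> = ip k k"
    have \<kappa>: "\<kappa> \<ge> 0" by (simp add: \<kappa>_def ip_self_nonneg)
    \<comment> \<open>The squared average will be bounded in the limit by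
      \<open>\<kappa> * c / n\<close>, so \<open>n\<close> is taken large enough to bring this below
      \<open>(\<epsilon> / 2)\<^sup>2\<close>.\<close>
    obtain n :: nat where n: "\<kappa> * c / (\<epsilon> / 2)\<^sup>2 < real n" using reals_Archimedean2 by blast
    moreover have "0 \<le> \<kappa> * c / (\<epsilon> / 2)\<^sup>2" using c \<kappa> by simp
    ultimately have n0: "real n > 0" by linarith
    obtain D :: "'k set" where D: "finite D" "card D = n" "0 \<notin> D" "inj_on (\<lambda>x. x\<^sup>2) D"
      using obtain_distinct_squares[OF inf] by blast
    have D_nz: "b \<noteq> 0" if "b \<in> D" for b using D(3) that by metis
    define y where "y u = (1 / real n) *\<^sub>R (\<Sum>b\<in>D. x (u * b))" for u
    have y_V [simp]: "y u \<in> V" if "u \<noteq> 0" for u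
      using that D_nz by (simp add: y_def)
    \<comment> \<open>Multiplicative invariance of the averages allows \<open>x u\<close> to be
      replaced by its mean \<open>y u\<close> over the dilates \<open>u * b\<close>.\<close>
    have "(\<lambda>N. avg (F N) (\<lambda>u. ip (x (u * b)) k) - s N) \<longlonglongrightarrow> 0" if "b \<in> D" for b
      unfolding s_def
    proof (rule double_folner_avg_mult[OF F(1) D_nz[OF that], of "- {0}" "\<lambda>u. ip (x u) k" "nrm h * nrm k"])
      show "\<bar>ip (x u) k\<bar> \<le> nrm h * nrm k" if "u \<in> - {0}" for u
        using that abs_ip_le[of "x u" k] by (simp add: x_def)
    qed (use D_nz[OF that] F_nz in auto)
    then have "(\<lambda>N. \<Sum>b\<in>D. avg (F N) (\<lambda>u. ip (x (u * b)) k) - s N) \<longlonglongrightarrow> (\<Sum>b\<in>D. 0)"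
      by (intro tendsto_sum)
    then have "(\<lambda>N. (1 / n) * (\<Sum>b\<in>D. avg (F N) (\<lambda>u. ip (x (u * b)) k) - s N)) \<longlonglongrightarrow> (1 / n) * 0"
      by (intro tendsto_mult tendsto_const) simp
    also have "(\<lambda>N. (1 / n) * (\<Sum>b\<in>D. avg (F N) (\<lambda>u. ip (x (u * b)) k) - s N))
        = (\<lambda>N. avg (F N) (\<lambda>u. ip (y u) k) - s N)"
    proof
      fix N
      have "avg (F N) (\<lambda>u. ip (y u) k) = avg (F N) (\<lambda>u. (1 / n) * (\<Sum>b\<in>D. ip (x (u * b)) k))"
        using D_nz F_nz by (intro avg_cong) (simp add: y_def ip_scaleR_left ip_sum_left)
      also have "\<dots> = (1 / n) * (\<Sum>b\<in>D. avg (F N) (\<lambda>u. ip (x (u * b)) k))"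
        by (simp only: avg_cmult avg_sum)
      finally show "(1 / n) * (\<Sum>b\<in>D. avg (F N) (\<lambda>u. ip (x (u * b)) k) - s N)
          = avg (F N) (\<lambda>u. ip (y u) k) - s N"
        using n0 D(2) by (simp add: sum_subtractf right_diff_distrib)
    qed
    finally have lim1: "(\<lambda>N. avg (F N) (\<lambda>u. ip (y u) k) - s N) \<longlonglongrightarrow> 0" by simp

    have corr: "(\<lambda>N. avg (F N) (\<lambda>u. ip (x (u * b)) (x (u * b')))) \<longlonglongrightarrow> (if b = b' then c else 0)"
      if "b \<in> D" "b' \<in> D" for b b'
    proof (cases "b = b'")
      case True
      have "avg (F N) (\<lambda>u. ip (x (u * b)) (x (u * b'))) = avg (F N) (\<lambda>u. c)" for N
        using True D_nz[OF that(1)] F_nz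
        by (intro avg_cong) (simp add: x_def ip_\<sigma> ip_\<tau> c_def)
      then show ?thesis using True by (simp add: avg_const)
    next
      case False
      then have "b - b'\<^sup>2 / b \<noteq> 0"
        using that D(4) D_nz[OF that(1)] by (auto simp: inj_on_def field_simps power2_eq_square)
      then have "(\<lambda>N. avg (F N) (\<lambda>u. ip (\<tau> (u * (b - b'\<^sup>2 / b)) h) (\<sigma> (b / b') h))) \<longlonglongrightarrow> 0"
        using D_nz that by (intro h) auto
      moreover have "avg (F N) (\<lambda>u. ip (\<tau> (u * (b - b'\<^sup>2 / b)) h) (\<sigma> (b / b') h))
          = avg (F N) (\<lambda>u. ip (x (u * b)) (x (u * b')))" for N
        unfolding x_def
        by (intro avg_cong ip_twisted_orbit[symmetric] F_nz[of _ N] D_nz that \<open>h \<in> V\<close>)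
      ultimately show ?thesis using False by simp
    qed
    \<comment> \<open>Of the \<open>n * n\<close> pairs only the \<open>n\<close> diagonal ones
      survive in the limit, each contributing \<open>c\<close>.\<close>
    have "(\<lambda>N. (1 / n)\<^sup>2 * (\<Sum>b\<in>D. \<Sum>b'\<in>D. avg (F N) (\<lambda>u. ip (x (u * b)) (x (u * b')))))
        \<longlonglongrightarrow> (1 / n)\<^sup>2 * (\<Sum>b\<in>D. \<Sum>b'\<in>D. if b = b' then c else 0)"
      by (intro tendsto_mult tendsto_const tendsto_sum corr)
    also have "(1 / n)\<^sup>2 * (\<Sum>b\<in>D. \<Sum>b'\<in>D. if b = b' then c else 0) = c / n"
      using D(1,2) n0 by (simp add: power2_eq_square)
    also have "(\<lambda>N. (1 / n)\<^sup>2 * (\<Sum>b\<in>D. \<Sum>b'\<in>D. avg (F N) (\<lambda>u. ip (x (u * b)) (x (u * b')))))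
        = (\<lambda>N. avg (F N) (\<lambda>u. ip (y u) (y u)))"
    proof
      fix N
      have "avg (F N) (\<lambda>u. ip (y u) (y u))
          = avg (F N) (\<lambda>u. (1 / n)\<^sup>2 * (\<Sum>b\<in>D. \<Sum>b'\<in>D. ip (x (u * b)) (x (u * b'))))"
      proof (rule avg_cong)
        fix u assume "u \<in> F N"
        then have [simp]: "x (u * b) \<in> V" if "b \<in> D" for b
          using that D_nz F_nz by simp
        have "ip (y u) (y u) = (1 / n)\<^sup>2 * ip (\<Sum>b\<in>D. x (u * b)) (\<Sum>b'\<in>D. x (u * b'))"
          by (simp add: y_def ip_scaleR_left ip_scaleR_right power2_eq_square)
        also have "ip (\<Sum>b\<in>D. x (u * b)) (\<Sum>b'\<in>D. x (u * b')) = (\<Sum>b\<in>D. ip (x (u * b)) (\<Sum>b'\<in>D. x (u * b')))"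
          by (rule ip_sum_left) simp_all
        also have "\<dots> = (\<Sum>b\<in>D. \<Sum>b'\<in>D. ip (x (u * b)) (x (u * b')))"
          by (intro sum.cong refl ip_sum_right) simp_all
        finally show "ip (y u) (y u) = (1 / n)\<^sup>2 * (\<Sum>b\<in>D. \<Sum>b'\<in>D. ip (x (u * b)) (x (u * b')))" .
      qed
      then show "(1 / n)\<^sup>2 * (\<Sum>b\<in>D. \<Sum>b'\<in>D. avg (F N) (\<lambda>u. ip (x (u * b)) (x (u * b'))))
          = avg (F N) (\<lambda>u. ip (y u) (y u))"
        by (simp only: avg_cmult avg_sum)
    qed
    finally have lim2: "(\<lambda>N. \<kappa> * avg (F N) (\<lambda>u. ip (y u) (y u))) \<longlonglongrightarrow> \<kappa> * (c / n)"
      by (intro tendsto_mult tendsto_const)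
    have "\<kappa> * (c / n) < (\<epsilon> / 2)\<^sup>2"
      using n n0 \<epsilon> by (simp add: field_simps)
    then have "\<forall>\<^sub>F N in sequentially. \<kappa> * avg (F N) (\<lambda>u. ip (y u) (y u)) < (\<epsilon> / 2)\<^sup>2"
      by (rule order_tendstoD(2)[OF lim2])
    moreover have "\<forall>\<^sub>F N in sequentially. \<bar>avg (F N) (\<lambda>u. ip (y u) k) - s N\<bar> < \<epsilon> / 2"
      using tendstoD[OF lim1, of "\<epsilon> / 2"] \<epsilon> by (simp add: dist_real_def)
    ultimately show ?thesis
    proof eventually_elim
      case (elim N)
      \<comment> \<open>Convexity of the square, then Cauchy-Schwarz pointwise in
        \<open>u\<close>.\<close>
      have "(avg (F N) (\<lambda>u. ip (y u) k))\<^sup>2 \<le> avg (F N) (\<lambda>u. (ip (y u) k)\<^sup>2)"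
        by (rule avg_square_le) simp_all
      also have "\<dots> \<le> avg (F N) (\<lambda>u. \<kappa> * ip (y u) (y u))"
        using F_nz ip_Cauchy_Schwarz[of "y _" k] by (intro avg_mono) (simp add: \<kappa>_def mult.commute)
      also have "\<dots> < (\<epsilon> / 2)\<^sup>2" using elim(1) by (simp add: avg_cmult)
      finally have "\<bar>avg (F N) (\<lambda>u. ip (y u) k)\<bar> < \<epsilon> / 2"
        using \<epsilon> by (intro power2_less_imp_less[of _ "\<epsilon> / 2"]) auto
      with elim(2) show ?case by linarith
    qed
  qed
  then show ?thesis
    unfolding s_def x_def by (intro tendstoI) (simp add: dist_real_def)
qed

text \<open>Midpoints replace general convex combinations because \<open>almost_fixed_point\<close>
  needs no more, and they keep every induction to four simple cases.\<close>

inductive_set orbit_hull :: "'v \<Rightarrow> 'v set" for f where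
  base: "f \<in> orbit_hull f"
| translate: "x \<in> orbit_hull f \<Longrightarrow> \<tau> w x \<in> orbit_hull f"
| dilate: "x \<in> orbit_hull f \<Longrightarrow> v \<noteq> 0 \<Longrightarrow> \<sigma> v x \<in> orbit_hull f"
| midpoint: "x \<in> orbit_hull f \<Longrightarrow> y \<in> orbit_hull f \<Longrightarrow> (1/2) *\<^sub>R (x + y) \<in> orbit_hull f"

lemma orbit_hull_V: "x \<in> orbit_hull f \<Longrightarrow> f \<in> V \<Longrightarrow> x \<in> V"
  by (induction rule: orbit_hull.induct) auto

text \<open>By adjointness the hypothesis bounds the linear functional \<open>ip k\<close> on the
  orbit of \<open>f\<close>, and such a bound passes to convex combinations. The induction varies
  \<open>k\<close>, since each group element is moved from \<open>x\<close> to \<open>k\<close>; the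
  commutation rule brings the result back to the form
  \<open>\<tau> w (\<sigma> v k)\<close>.\<close>

lemma ip_orbit_hull_le:
  assumes "x \<in> orbit_hull f" "f \<in> V" "k \<in> V" "\<And>w v. v \<noteq> 0 \<Longrightarrow> ip (\<tau> w (\<sigma> v k)) f \<le> r"
  shows "ip k x \<le> r"
  using assms(1,3,4)
proof (induction arbitrary: k rule: orbit_hull.induct)
  case base
  then show ?case using base(2)[of 1 0] by simp
next
  case (translate x w)
  have [simp]: "x \<in> V" using translate(1) assms(2) by (rule orbit_hull_V)
  have "ip (\<tau> (- w) k) x \<le> r"
    using translate.prems by (intro translate.IH) (simp_all add: \<sigma>_\<tau> \<tau>_\<tau>)
  then show ?case using translate.prems by (simp add: ip_\<tau>_right)
next
  case (dilate x v)
  have [simp]: "x \<in> V" using dilate(1) assms(2) by (rule orbit_hull_V)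
  have "ip (\<sigma> (inverse v) k) x \<le> r"
    using dilate.prems dilate.hyps by (intro dilate.IH) (simp_all add: \<sigma>_\<sigma>)
  then show ?case using dilate.prems dilate.hyps by (simp add: ip_\<sigma>_right)
next
  case (midpoint x y)
  have [simp]: "x \<in> V" "y \<in> V" using midpoint.hyps assms(2) by (auto intro: orbit_hull_V)
  have "ip k x \<le> r" "ip k y \<le> r" using midpoint by auto
  then show ?case using midpoint.prems(1) by (simp add: ip_simps)
qed

text \<open>Pairing with an invariant vector is constant on the orbit, hence on its hull. For
  \<open>e\<close> the constant function one this says that integrals are preserved.\<close>

lemma ip_orbit_hull_invariant:
  assumes "x \<in> orbit_hull f" "f \<in> V" "e \<in> V" "\<And>w. \<tau> w e = e" "\<And>v. v \<noteq> 0 \<Longrightarrow> \<sigma> v e = e"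
  shows "ip x e = ip f e"
  using assms(1)
proof (induction rule: orbit_hull.induct)
  case (translate x w)
  then show ?case using ip_\<tau>[of x e w] assms orbit_hull_V by simp
next
  case (dilate x v)
  then show ?case using ip_\<sigma>[of v x e] assms orbit_hull_V by simp
next
  case (midpoint x y)
  then have "x \<in> V" "y \<in> V" using assms(2) by (auto intro: orbit_hull_V)
  then show ?case using midpoint assms(3) by (simp add: ip_simps)
qed simp

lemma nrm_midpoint_le:
  assumes "x \<in> V" "y \<in> V" "nrm x \<le> \<epsilon>" "nrm y \<le> \<epsilon>"
  shows "nrm ((1/2) *\<^sub>R (x + y)) \<le> \<epsilon>"
  using assms nrm_triangle[of x y] by (simp add: nrm_scaleR)

text \<open>An approximate mean ergodic theorem for translations. The \<open>c\<close> for which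
  \<open>f - c\<close> has vanishing averages form a midpoint-convex set that contains
  \<open>f\<close> and is stable under translations, so it has an almost fixed point. The factor
  \<open>\<alpha>\<close> is there for the coefficients \<open>b - b'\<^sup>2 / b\<close> of van der
  Corput's trick.\<close>

lemma almost_translation_invariant:
  fixes F :: "nat \<Rightarrow> 'k set"
  assumes F: "double_folner F" and [simp]: "f \<in> V" and \<epsilon>: "\<epsilon> > 0"
  obtains c where "c \<in> orbit_hull f" "\<And>w. nrm (\<tau> w c - c) \<le> \<epsilon>"
    "\<And>k \<alpha>. k \<in> V \<Longrightarrow> \<alpha> \<noteq> 0 \<Longrightarrow> (\<lambda>N. avg (F N) (\<lambda>u. ip (\<tau> (u * \<alpha>) (f - c)) k)) \<longlonglongrightarrow> 0"
proof -
  define C where "C = {c \<in> orbit_hull f. \<forall>k\<in>V. \<forall>\<alpha>. \<alpha> \<noteq> 0 \<longrightarrow>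
    (\<lambda>N. avg (F N) (\<lambda>u. ip (\<tau> (u * \<alpha>) (f - c)) k)) \<longlonglongrightarrow> 0}"
  have C_V: "c \<in> V" if "c \<in> C" for c
    using that orbit_hull_V[of c f] by (simp add: C_def)
  obtain c where "c \<in> C" "\<And>w. w \<in> UNIV \<Longrightarrow> nrm (\<tau> w c - c) \<le> \<epsilon>"
  proof (rule almost_fixed_point[of C f UNIV \<tau> \<epsilon>])
    show "C \<subseteq> V" using C_V by blast
    have "\<tau> w 0 = 0" for w using \<tau>_linear(2)[of 0 w 0] by simp
    then show "f \<in> C" by (simp add: C_def orbit_hull.base avg_def)
  next
    fix x y assume xy: "x \<in> C" "y \<in> C"
    note [simp] = C_V[OF xy(1)] C_V[OF xy(2)]
    have "(\<lambda>N. avg (F N) (\<lambda>u. ip (\<tau> (u * \<alpha>) (f - (1/2) *\<^sub>R (x + y))) k)) \<longlonglongrightarrow> 0"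
      if k: "k \<in> V" "\<alpha> \<noteq> 0" for k \<alpha>
    proof -
      have "(\<lambda>N. (1/2) * (avg (F N) (\<lambda>u. ip (\<tau> (u * \<alpha>) (f - x)) k)
          + avg (F N) (\<lambda>u. ip (\<tau> (u * \<alpha>) (f - y)) k))) \<longlonglongrightarrow> (1/2) * (0 + 0)"
        using xy k unfolding C_def by (intro tendsto_mult tendsto_add tendsto_const) auto
      moreover have "ip (\<tau> w (f - (1/2) *\<^sub>R (x + y))) k
          = (1/2) * (ip (\<tau> w (f - x)) k + ip (\<tau> w (f - y)) k)" for w
        using k by (simp add: \<tau>_linear \<tau>_diff ip_simps field_simps)
      ultimately show ?thesis by (simp only: avg_cmult avg_add) simp
    qed
    then show "(1/2) *\<^sub>R (x + y) \<in> C" using xy by (simp add: C_def orbit_hull.midpoint)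
  next
    fix w x assume x: "x \<in> C"
    note [simp] = C_V[OF x]
    have "(\<lambda>N. avg (F N) (\<lambda>u. ip (\<tau> (u * \<alpha>) (f - \<tau> w x)) k)) \<longlonglongrightarrow> 0"
      if k: "k \<in> V" "\<alpha> \<noteq> 0" for k \<alpha>
    proof -
      \<comment> \<open>Translating \<open>x\<close> by \<open>w\<close> amounts to shifting the
        averaging variable by \<open>w / \<alpha>\<close>, which additive invariance of the averages
        absorbs.\<close>
      have "(\<lambda>N. avg (F N) (\<lambda>u. ip (\<tau> (u * \<alpha>) (f - x)) k)
          - (avg (F N) (\<lambda>u. ip (\<tau> ((u + w / \<alpha>) * \<alpha>) x) k) - avg (F N) (\<lambda>u. ip (\<tau> (u * \<alpha>) x) k)))
          \<longlonglongrightarrow> 0 - 0"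
      proof (intro tendsto_diff[OF _ double_folner_avg_add[OF F, where C = "nrm x * nrm k"]])
        show "\<bar>ip (\<tau> (u * \<alpha>) x) k\<bar> \<le> nrm x * nrm k" for u
          using abs_ip_le[of "\<tau> (u * \<alpha>) x" k] k by simp
      qed (use x k in \<open>auto simp: C_def\<close>)
      moreover have "ip (\<tau> (u * \<alpha>) (f - \<tau> w x)) k = ip (\<tau> (u * \<alpha>) (f - x)) k
          - (ip (\<tau> ((u + w / \<alpha>) * \<alpha>) x) k - ip (\<tau> (u * \<alpha>) x) k)" for u
        using k by (simp add: \<tau>_diff \<tau>_\<tau> ip_simps distrib_right)
      ultimately show ?thesis by (simp only: avg_diff diff_0_right)
    qed
    then show "\<tau> w x \<in> C" using x by (simp add: C_def orbit_hull.translate)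
    show "ip (\<tau> w x) (\<tau> w x) = ip x x" by (simp add: ip_\<tau>)
  qed (use \<epsilon> in auto)
  then show thesis by (intro that[of c]) (auto simp: C_def)
qed

text \<open>The same argument for dilations, started from \<open>c\<close>. Almost invariance under
  translations is carried along as part of \<open>C\<close>, because dilations and midpoints
  preserve it.\<close>

lemma almost_dilation_invariant:
  fixes F :: "nat \<Rightarrow> 'k set"
  assumes F: "double_folner F" "\<And>N. 0 \<notin> F N" and f [simp]: "f \<in> V" and \<epsilon>: "\<epsilon> > 0"
    and c: "c \<in> orbit_hull f" "\<And>w. nrm (\<tau> w c - c) \<le> \<epsilon>"
  obtains d where "d \<in> orbit_hull f" "\<And>w. nrm (\<tau> w d - d) \<le> \<epsilon>"
    "\<And>v. v \<noteq> 0 \<Longrightarrow> nrm (\<sigma> v d - d) \<le> \<epsilon>"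
    "(\<lambda>N. avg (F N) (\<lambda>u. ip (\<sigma> (inverse u) (c - d)) f)) \<longlonglongrightarrow> 0"
proof -
  have F_nz: "u \<noteq> 0" if "u \<in> F N" for u N using F(2) that by metis
  have [simp]: "c \<in> V" using c(1) f by (rule orbit_hull_V)
  define C where "C = {d \<in> orbit_hull f. (\<forall>w. nrm (\<tau> w d - d) \<le> \<epsilon>) \<and>
    (\<lambda>N. avg (F N) (\<lambda>u. ip (\<sigma> (inverse u) (c - d)) f)) \<longlonglongrightarrow> 0}"
  have C_V: "d \<in> V" if "d \<in> C" for d
    using that orbit_hull_V[of d f] by (simp add: C_def)
  obtain d where "d \<in> C" "\<And>v. v \<in> - {0} \<Longrightarrow> nrm (\<sigma> v d - d) \<le> \<epsilon>"
  proof (rule almost_fixed_point[of C c "- {0}" \<sigma> \<epsilon>])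
    show "C \<subseteq> V" using C_V by blast
    have \<sigma>0: "\<sigma> v 0 = 0" if "v \<noteq> 0" for v using \<sigma>_linear(2)[of v 0 0] that by simp
    have "avg (F N) (\<lambda>u. ip (\<sigma> (inverse u) 0) f) = 0" for N
      using F_nz by (subst avg_cong[where b = "\<lambda>u. 0"]) (simp_all add: \<sigma>0 avg_def)
    then show "c \<in> C" using c by (simp add: C_def)
  next
    fix x y assume xy: "x \<in> C" "y \<in> C"
    note [simp] = C_V[OF xy(1)] C_V[OF xy(2)]
    have "(\<lambda>N. (1/2) * (avg (F N) (\<lambda>u. ip (\<sigma> (inverse u) (c - x)) f)
        + avg (F N) (\<lambda>u. ip (\<sigma> (inverse u) (c - y)) f))) \<longlonglongrightarrow> (1/2) * (0 + 0)"
      using xy unfolding C_def by (intro tendsto_mult tendsto_add tendsto_const) auto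
    moreover have "avg (F N) (\<lambda>u. ip (\<sigma> (inverse u) (c - (1/2) *\<^sub>R (x + y))) f)
        = avg (F N) (\<lambda>u. (1/2) * (ip (\<sigma> (inverse u) (c - x)) f + ip (\<sigma> (inverse u) (c - y)) f))" for N
      using F_nz by (intro avg_cong) (simp add: \<sigma>_linear \<sigma>_diff ip_simps field_simps)
    ultimately have "(\<lambda>N. avg (F N) (\<lambda>u. ip (\<sigma> (inverse u) (c - (1/2) *\<^sub>R (x + y))) f)) \<longlonglongrightarrow> 0"
      by (simp only: avg_cmult avg_add) simp
    moreover have "nrm (\<tau> w ((1/2) *\<^sub>R (x + y)) - (1/2) *\<^sub>R (x + y)) \<le> \<epsilon>" for w
    proof -
      have "\<tau> w ((1/2) *\<^sub>R (x + y)) - (1/2) *\<^sub>R (x + y) = (1/2) *\<^sub>R ((\<tau> w x - x) + (\<tau> w y - y))"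
        by (simp add: \<tau>_linear algebra_simps)
      then show ?thesis using xy by (auto simp: C_def simp del: scaleR_add_right intro!: nrm_midpoint_le)
    qed
    ultimately show "(1/2) *\<^sub>R (x + y) \<in> C" using xy by (simp add: C_def orbit_hull.midpoint)
  next
    fix v x assume v: "v \<in> - {0 :: 'k}" and x: "x \<in> C"
    note [simp] = C_V[OF x]
    from v have [simp]: "v \<noteq> 0" by simp
    \<comment> \<open>Applying \<open>\<sigma> v\<close> to \<open>x\<close> amounts to multiplying
      the averaging variable by \<open>inverse v\<close>.\<close>
    have "(\<lambda>N. avg (F N) (\<lambda>u. ip (\<sigma> (inverse u) (c - x)) f)
        - (avg (F N) (\<lambda>u. ip (\<sigma> (inverse (u * inverse v)) x) f) - avg (F N) (\<lambda>u. ip (\<sigma> (inverse u) x) f)))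
        \<longlonglongrightarrow> 0 - 0"
    proof (intro tendsto_diff[OF _ double_folner_avg_mult[OF F(1), where D = "- {0}" and C = "nrm x * nrm f"]])
      show "\<bar>ip (\<sigma> (inverse u) x) f\<bar> \<le> nrm x * nrm f" if "u \<in> - {0}" for u
        using abs_ip_le[of "\<sigma> (inverse u) x" f] that by simp
    qed (use x F_nz in \<open>auto simp: C_def\<close>)
    moreover have "avg (F N) (\<lambda>u. ip (\<sigma> (inverse u) (c - \<sigma> v x)) f)
        = avg (F N) (\<lambda>u. ip (\<sigma> (inverse u) (c - x)) f
          - (ip (\<sigma> (inverse (u * inverse v)) x) f - ip (\<sigma> (inverse u) x) f))" for N
      using F_nz by (intro avg_cong) (simp add: \<sigma>_diff \<sigma>_\<sigma> ip_simps mult.commute)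
    ultimately have "(\<lambda>N. avg (F N) (\<lambda>u. ip (\<sigma> (inverse u) (c - \<sigma> v x)) f)) \<longlonglongrightarrow> 0"
      by (simp only: avg_diff diff_0_right)
    \<comment> \<open>The bound for \<open>x\<close> holds for all translations at once, so the
      rescaling of \<open>w\<close> by \<open>v\<close> does no harm.\<close>
    moreover have "nrm (\<tau> w (\<sigma> v x) - \<sigma> v x) \<le> \<epsilon>" for w
    proof -
      have "\<tau> w (\<sigma> v x) - \<sigma> v x = \<sigma> v (\<tau> (v * w) x - x)"
        by (simp add: \<tau>_\<sigma> \<sigma>_diff)
      then show ?thesis using x by (simp add: C_def)
    qed
    ultimately show "\<sigma> v x \<in> C" using x by (simp add: C_def orbit_hull.dilate)
    show "ip (\<sigma> v x) (\<sigma> v x) = ip x x" by (simp add: ip_\<sigma>)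
  qed (use \<epsilon> in auto)
  then show thesis by (intro that[of d]) (auto simp: C_def)
qed

section \<open>Lower bound for the averaged correlations\<close>

lemma ip_almost_eq:
  assumes "x \<in> V" "y \<in> V" "f \<in> V" "nrm (x - y) \<le> \<epsilon>"
  shows "\<bar>ip x f - ip y f\<bar> \<le> \<epsilon> * nrm f"
proof -
  have "\<bar>ip x f - ip y f\<bar> \<le> nrm (x - y) * nrm f"
    using abs_ip_le[of "x - y" f] assms by (simp add: ip_diff_left)
  also have "\<dots> \<le> \<epsilon> * nrm f" using assms by (intro mult_right_mono) auto
  finally show ?thesis .
qed

text \<open>As \<open>d\<close> is almost invariant, it has almost the same product with every point
  of the orbit of \<open>f\<close>. Since \<open>d\<close> lies in the hull of that orbit,
  \<open>ip d d\<close> exceeds \<open>ip d f\<close> by at most the error. Cauchy-Schwarz against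
  the invariant unit vector \<open>e\<close> bounds \<open>ip d d\<close> from below.\<close>

lemma ip_almost_invariant_ge:
  assumes d: "d \<in> orbit_hull f" "\<And>w. nrm (\<tau> w d - d) \<le> \<epsilon>" "\<And>v. v \<noteq> 0 \<Longrightarrow> nrm (\<sigma> v d - d) \<le> \<epsilon>"
    and f: "f \<in> V" and e: "e \<in> V" "\<And>w. \<tau> w e = e" "\<And>v. v \<noteq> 0 \<Longrightarrow> \<sigma> v e = e" "ip e e = 1"
  shows "(ip f e)\<^sup>2 - 2 * \<epsilon> * nrm f \<le> ip d f"
proof -
  have dV [simp]: "d \<in> V" using d(1) f by (rule orbit_hull_V)
  have "ip d d \<le> ip d f + 2 * \<epsilon> * nrm f"
  proof (rule ip_orbit_hull_le[OF d(1) f dV])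
    fix w v :: 'k assume v: "v \<noteq> 0"
    have "nrm (\<tau> w (\<sigma> v d - d)) \<le> \<epsilon>" using d(3) v by simp
    then have "\<bar>ip (\<tau> w (\<sigma> v d)) f - ip (\<tau> w d) f\<bar> \<le> \<epsilon> * nrm f"
      using v f by (intro ip_almost_eq) (simp_all add: \<tau>_diff)
    moreover have "\<bar>ip (\<tau> w d) f - ip d f\<bar> \<le> \<epsilon> * nrm f"
      using d(2) f by (intro ip_almost_eq) simp_all
    ultimately show "ip (\<tau> w (\<sigma> v d)) f \<le> ip d f + 2 * \<epsilon> * nrm f" by linarith
  qed
  moreover have "(ip f e)\<^sup>2 \<le> ip d d"
    using ip_Cauchy_Schwarz[of d e] ip_orbit_hull_invariant[OF d(1) f e(1-3)] e by simp
  ultimately show ?thesis by linarith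
qed

text \<open>The vector \<open>\<sigma> (inverse u) (\<tau> u f)\<close> is split along
  \<open>f = (f - c) + c\<close>. The first part averages out by van der Corput, and the second is
  almost \<open>\<sigma> (inverse u) c\<close>. There \<open>c - d\<close> averages out as well, and
  \<open>d\<close> is almost unmoved.\<close>

theorem avg_correlation_ge:
  fixes F :: "nat \<Rightarrow> 'k set"
  assumes inf: "infinite (UNIV :: 'k set)" and F: "double_folner F" "\<And>N. 0 \<notin> F N"
    and f [simp]: "f \<in> V"
    and e: "e \<in> V" "\<And>w. \<tau> w e = e" "\<And>v. v \<noteq> 0 \<Longrightarrow> \<sigma> v e = e" "ip e e = 1"
    and \<eta>: "\<eta> > 0"
  shows "\<forall>\<^sub>F N in sequentially. (ip f e)\<^sup>2 - \<eta> < avg (F N) (\<lambda>u. ip (\<tau> u f) (\<sigma> u f))"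
proof -
  have F_nz: "u \<noteq> 0" if "u \<in> F N" for u N using F(2) that by metis
  define B where "B = nrm f"
  have B: "B \<ge> 0" by (simp add: B_def)
  \<comment> \<open>Four errors of size \<open>\<epsilon> * B\<close> occur: one for translating
    \<open>c\<close>, one for dilating \<open>d\<close>, two from
    \<open>ip_almost_invariant_ge\<close>. The summand \<open>8\<close> keeps the denominator
    positive if \<open>B = 0\<close>.\<close>
  define \<epsilon> where "\<epsilon> = \<eta> / (8 * B + 8)"
  have \<epsilon>: "\<epsilon> > 0" using \<eta> B by (simp add: \<epsilon>_def)
  have \<epsilon>B: "4 * (\<epsilon> * B) \<le> \<eta> / 2" using \<eta> B by (simp add: \<epsilon>_def field_simps)
  obtain c where c: "c \<in> orbit_hull f" "\<And>w. nrm (\<tau> w c - c) \<le> \<epsilon>"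
    "\<And>k \<alpha>. k \<in> V \<Longrightarrow> \<alpha> \<noteq> 0 \<Longrightarrow> (\<lambda>N. avg (F N) (\<lambda>u. ip (\<tau> (u * \<alpha>) (f - c)) k)) \<longlonglongrightarrow> 0"
    using almost_translation_invariant[OF F(1) f \<epsilon>] by metis
  obtain d where d: "d \<in> orbit_hull f" "\<And>w. nrm (\<tau> w d - d) \<le> \<epsilon>"
    "\<And>v. v \<noteq> 0 \<Longrightarrow> nrm (\<sigma> v d - d) \<le> \<epsilon>"
    "(\<lambda>N. avg (F N) (\<lambda>u. ip (\<sigma> (inverse u) (c - d)) f)) \<longlonglongrightarrow> 0"
    using almost_dilation_invariant[OF F f \<epsilon> c(1,2)] by metis
  have [simp]: "c \<in> V" "d \<in> V" using c(1) d(1) f by (auto intro: orbit_hull_V)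
  have "(\<lambda>N. avg (F N) (\<lambda>u. ip (\<sigma> (inverse u) (\<tau> u (f - c))) f)) \<longlonglongrightarrow> 0"
    by (rule van_der_Corput[OF inf F _ _ c(3)]) simp_all
  from tendsto_add[OF this d(4)]
  have "\<forall>\<^sub>F N in sequentially. - (\<eta> / 2) < avg (F N) (\<lambda>u. ip (\<sigma> (inverse u) (\<tau> u (f - c))) f
      + ip (\<sigma> (inverse u) (c - d)) f)"
    using \<eta> unfolding avg_add by (intro order_tendstoD) auto
  then show ?thesis
  proof eventually_elim
    case (elim N)
    have "(ip f e)\<^sup>2 - \<eta> < avg (F N) (\<lambda>u. ip (\<sigma> (inverse u) (\<tau> u (f - c))) f
        + ip (\<sigma> (inverse u) (c - d)) f) + ((ip f e)\<^sup>2 - 4 * (\<epsilon> * B))"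
      using elim \<epsilon>B by linarith
    also have "\<dots> = avg (F N) (\<lambda>u. (ip (\<sigma> (inverse u) (\<tau> u (f - c))) f
        + ip (\<sigma> (inverse u) (c - d)) f) + ((ip f e)\<^sup>2 - 4 * (\<epsilon> * B)))"
      using F(1) by (simp add: avg_add[where b = "\<lambda>u. _ - _"] avg_const double_folner_finite double_folner_nonempty)
    also have "\<dots> \<le> avg (F N) (\<lambda>u. ip (\<tau> u f) (\<sigma> u f))"
    proof (rule avg_mono)
      fix u assume "u \<in> F N"
      then have u [simp]: "u \<noteq> 0" by (rule F_nz)
      have "nrm (\<sigma> (inverse u) (\<tau> u c - c)) \<le> \<epsilon>" using c(2) by simp
      then have "\<bar>ip (\<sigma> (inverse u) (\<tau> u c)) f - ip (\<sigma> (inverse u) c) f\<bar> \<le> \<epsilon> * B"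
        unfolding B_def by (intro ip_almost_eq) (simp_all add: \<sigma>_diff)
      moreover have "\<bar>ip (\<sigma> (inverse u) d) f - ip d f\<bar> \<le> \<epsilon> * B"
        unfolding B_def using d(3) by (intro ip_almost_eq) simp_all
      moreover have "(ip f e)\<^sup>2 - 2 * (\<epsilon> * B) \<le> ip d f"
        using ip_almost_invariant_ge[OF d(1-3) f e] by (simp add: B_def mult.assoc)
      moreover have "ip (\<tau> u f) (\<sigma> u f) = ip (\<sigma> (inverse u) (\<tau> u f)) f"
        by (simp add: ip_\<sigma>_right)
      ultimately show "(ip (\<sigma> (inverse u) (\<tau> u (f - c))) f
          + ip (\<sigma> (inverse u) (c - d)) f) + ((ip f e)\<^sup>2 - 4 * (\<epsilon> * B)) \<le> ip (\<tau> u f) (\<sigma> u f)"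
        by (simp add: \<tau>_diff \<sigma>_diff ip_diff_left)
    qed
    finally show ?case .
  qed
qed

end

section \<open>Koopman representations\<close>

text \<open>Pointwise scaling makes the function type an instance of the class over which
  \<open>semi_inner_product\<close> is stated; addition is already pointwise.\<close>

instantiation "fun" :: (type, real_vector) real_vector
begin

definition scaleR_fun :: "real \<Rightarrow> ('a \<Rightarrow> 'b) \<Rightarrow> 'a \<Rightarrow> 'b" where
  "scaleR_fun c f = (\<lambda>x. c *\<^sub>R f x)"

instance
  by standard (auto simp: scaleR_fun_def fun_eq_iff algebra_simps)

end

section \<open>Koopman operators of translations and dilations\<close>

lemma add_map_in_affine_group [simp]: "add_map u \<in> affine_group"
  unfolding affine_group_def add_map_def by (rule CollectI, rule exI[of _ u], rule exI[of _ 1]) simp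

lemma mult_map_in_affine_group [simp]: "u \<noteq> 0 \<Longrightarrow> mult_map u \<in> affine_group"
  unfolding affine_group_def mult_map_def by (rule CollectI, rule exI[of _ 0], rule exI[of _ u]) simp

lemma add_map_0: "add_map 0 = id" by (auto simp: add_map_def)

lemma mult_map_1: "mult_map 1 = id" by (auto simp: mult_map_def)

lemma add_map_comp: "add_map u \<circ> add_map w = add_map (w + u)"
  by (auto simp: add_map_def ac_simps)

lemma mult_map_comp: "mult_map u \<circ> mult_map v = mult_map (u * v)"
  by (auto simp: mult_map_def ac_simps)

lemma mult_map_comp_add_map: "mult_map v \<circ> add_map w = add_map (v * w) \<circ> mult_map v"
  by (auto simp: mult_map_def add_map_def algebra_simps)

context affine_pmp_system
begin

text \<open>Functions are normalised to vanish off \<open>space M\<close>, where \<open>T\<close> is unconstrained, so that the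
  action laws become equations between functions.\<close>

definition bounded_functions :: "('x \<Rightarrow> real) set" where
  "bounded_functions = {f \<in> borel_measurable M. (\<exists>C. \<forall>x. \<bar>f x\<bar> \<le> C) \<and> (\<forall>x. x \<notin> space M \<longrightarrow> f x = 0)}"

definition koopman :: "('k \<Rightarrow> 'k) \<Rightarrow> ('x \<Rightarrow> real) \<Rightarrow> 'x \<Rightarrow> real" where
  "koopman g f = (\<lambda>x. if x \<in> space M then f (T g x) else 0)"

lemma T_space: "g \<in> affine_group \<Longrightarrow> x \<in> space M \<Longrightarrow> T g x \<in> space M"
  by (rule measurable_space[OF T_measurable])

lemma distr_T:
  assumes g: "g \<in> affine_group"
  shows "distr M M (T g) = M"
proof (rule measure_eqI)
  fix A assume "A \<in> sets (distr M M (T g))"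
  then have A: "A \<in> sets M" by simp
  then have "emeasure (distr M M (T g)) A = emeasure M (T g -` A \<inter> space M)"
    by (rule emeasure_distr[OF T_measurable[OF g]])
  also have "\<dots> = emeasure M A"
    using T_preserving[OF g A] by (simp add: emeasure_eq_measure)
  finally show "emeasure (distr M M (T g)) A = emeasure M A" .
qed simp

lemma integral_T:
  fixes f :: "'x \<Rightarrow> real"
  assumes g: "g \<in> affine_group" and "f \<in> borel_measurable M"
  shows "(\<integral>x. f (T g x) \<partial>M) = (\<integral>x. f x \<partial>M)"
  using integral_distr[OF T_measurable[OF g] assms(2)] by (simp add: distr_T[OF g])

lemma bounded_functions_measurable: "f \<in> bounded_functions \<Longrightarrow> f \<in> borel_measurable M"
  by (simp add: bounded_functions_def)

lemma bounded_functions_bound: "f \<in> bounded_functions \<Longrightarrow> \<exists>C. \<forall>x. \<bar>f x\<bar> \<le> C"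
  by (simp add: bounded_functions_def)

lemma bounded_functions_mult_integrable:
  assumes "f \<in> bounded_functions" "g \<in> bounded_functions"
  shows "integrable M (\<lambda>x. f x * g x)"
proof -
  obtain C where C: "\<forall>x. \<bar>f x\<bar> \<le> C"
    using bounded_functions_bound[OF assms(1)] ..
  obtain D where D: "\<forall>x. \<bar>g x\<bar> \<le> D"
    using bounded_functions_bound[OF assms(2)] ..
  have "\<bar>f x * g x\<bar> \<le> C * D" for x
    unfolding abs_mult using C[rule_format, of x] D[rule_format, of x] by (intro mult_mono) auto
  then show ?thesis
    using assms[THEN bounded_functions_measurable] by (intro integrable_const_bound[of _ "C * D"]) auto
qed

lemma koopman_bounded_functions:
  assumes g: "g \<in> affine_group" and f: "f \<in> bounded_functions"
  shows "koopman g f \<in> bounded_functions"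
proof -
  obtain C where C: "\<forall>x. \<bar>f x\<bar> \<le> C"
    using bounded_functions_bound[OF f] ..
  have "(\<lambda>x. f (T g x)) \<in> borel_measurable M"
    using measurable_comp[OF T_measurable[OF g] bounded_functions_measurable[OF f]] by (simp add: comp_def)
  then have "koopman g f \<in> borel_measurable M"
    by (rule measurable_cong[THEN iffD1, rotated]) (simp add: koopman_def)
  moreover have "\<bar>koopman g f x\<bar> \<le> C" for x
    using C[rule_format, of "T g x"] by (auto simp: koopman_def)
  moreover have "koopman g f x = 0" if "x \<notin> space M" for x
    using that by (simp add: koopman_def)
  ultimately show ?thesis
    unfolding bounded_functions_def by blast
qed

lemma koopman_koopman:
  assumes "g \<in> affine_group" "h \<in> affine_group"
  shows "koopman h (koopman g f) = koopman (g \<circ> h) f"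
  using assms by (auto simp: koopman_def T_space T_comp)

lemma koopman_add: "koopman g (f + f') = koopman g f + koopman g f'"
  by (auto simp: koopman_def)

lemma koopman_scaleR: "koopman g (c *\<^sub>R f) = c *\<^sub>R koopman g f"
  by (auto simp: koopman_def scaleR_fun_def)

lemma koopman_id: "f \<in> bounded_functions \<Longrightarrow> koopman id f = f"
  by (auto simp: koopman_def T_id bounded_functions_def)

lemma integral_koopman_mult:
  assumes g: "g \<in> affine_group" and "f \<in> bounded_functions" "f' \<in> bounded_functions"
  shows "(\<integral>x. koopman g f x * koopman g f' x \<partial>M) = (\<integral>x. f x * f' x \<partial>M)"
proof -
  have "(\<integral>x. koopman g f x * koopman g f' x \<partial>M) = (\<integral>x. f (T g x) * f' (T g x) \<partial>M)"
    by (intro Bochner_Integration.integral_cong) (auto simp: koopman_def)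
  also have "\<dots> = (\<integral>x. f x * f' x \<partial>M)"
    using assms by (intro integral_T[where f = "\<lambda>x. f x * f' x"]) (auto simp: bounded_functions_def)
  finally show ?thesis .
qed

sublocale koopman: affine_isometries bounded_functions "\<lambda>f f'. \<integral>x. f x * f' x \<partial>M"
  "\<lambda>w. koopman (add_map w)" "\<lambda>v. koopman (mult_map v)"
proof unfold_locales
  show "subspace bounded_functions"
    unfolding subspace_def
  proof (intro conjI ballI allI)
    show "0 \<in> bounded_functions" by (auto simp: bounded_functions_def zero_fun_def)
  next
    fix f f' assume f: "f \<in> bounded_functions" "f' \<in> bounded_functions"
    obtain C where C: "\<forall>x. \<bar>f x\<bar> \<le> C" using bounded_functions_bound[OF f(1)] ..
    obtain D where D: "\<forall>x. \<bar>f' x\<bar> \<le> D" using bounded_functions_bound[OF f(2)] ..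
    have "\<bar>f x + f' x\<bar> \<le> C + D" for x using C[rule_format, of x] D[rule_format, of x] by linarith
    then show "f + f' \<in> bounded_functions" using f by (auto simp: bounded_functions_def plus_fun_def)
  next
    fix c :: real and f assume f: "f \<in> bounded_functions"
    obtain C where C: "\<forall>x. \<bar>f x\<bar> \<le> C" using bounded_functions_bound[OF f] ..
    have "\<bar>c * f x\<bar> \<le> \<bar>c\<bar> * C" for x using C[rule_format, of x] by (simp add: abs_mult mult_left_mono)
    then show "c *\<^sub>R f \<in> bounded_functions" using f by (auto simp: bounded_functions_def scaleR_fun_def)
  qed
next
  fix f f' f'' assume "f \<in> bounded_functions" "f' \<in> bounded_functions" "f'' \<in> bounded_functions"
  then show "(\<integral>x. (f + f') x * f'' x \<partial>M) = (\<integral>x. f x * f'' x \<partial>M) + (\<integral>x. f' x * f'' x \<partial>M)"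
    by (simp add: distrib_right bounded_functions_mult_integrable)
next
  fix f f' :: "'x \<Rightarrow> real" and c :: real
  show "(\<integral>x. (c *\<^sub>R f) x * f' x \<partial>M) = c * (\<integral>x. f x * f' x \<partial>M)"
    by (simp add: scaleR_fun_def mult.assoc)
  show "(\<integral>x. f x * f' x \<partial>M) = (\<integral>x. f' x * f x \<partial>M)"
    by (simp add: mult.commute)
qed (simp_all add: koopman_bounded_functions koopman_add koopman_scaleR koopman_koopman koopman_id
    integral_koopman_mult add_map_0 mult_map_1 add_map_comp mult_map_comp mult_map_comp_add_map mult.commute)

text \<open>Along a double Folner sequence avoiding both the return set and \<open>0\<close>, every
  correlation is at most \<open>\<delta> * (measure M B)\<^sup>2\<close>, and so is every average.
  This contradicts \<open>avg_correlation_ge\<close> for the indicator of \<open>B\<close> and the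
  invariant unit vector \<open>e\<close>.\<close>

lemma affinely_syndetic_return_set:
  assumes "countable (UNIV :: 'k set)" "infinite (UNIV :: 'k set)"
    and B: "B \<in> sets M" "measure M B > 0" and \<delta>: "\<delta> < 1"
  shows "affinely_syndetic (return_set M T B \<delta>)"
proof (rule ccontr)
  assume "\<not> affinely_syndetic (return_set M T B \<delta>)"
  then obtain F where F: "double_folner F" "\<And>N. F N \<inter> return_set M T B \<delta> = {}" "\<And>N. 0 \<notin> F N"
    using double_folner_avoiding[OF assms(1,2)] by metis
  define f :: "'x \<Rightarrow> real" where "f = indicator B"
  define e :: "'x \<Rightarrow> real" where "e = indicator (space M)"
  have B_space: "B \<subseteq> space M" using B(1) by (rule sets.sets_into_space)
  have f: "f \<in> bounded_functions" and e: "e \<in> bounded_functions"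
    using B B_space by (auto simp: bounded_functions_def f_def e_def indicator_def intro!: exI[of _ 1])
  have e_inv: "koopman g e = e" if "g \<in> affine_group" for g
    using T_space[OF that] by (auto simp: koopman_def e_def)
  have "(\<lambda>x. f x * e x) = indicator B" "(\<lambda>x. e x * e x) = indicator (space M)"
    using B_space by (auto simp: f_def e_def indicator_def fun_eq_iff)
  then have fe: "(\<integral>x. f x * e x \<partial>M) = measure M B" "(\<integral>x. e x * e x \<partial>M) = 1"
    using B_space by (simp_all add: Int_absorb2 prob_space)
  \<comment> \<open>Chosen so that \<open>(measure M B)\<^sup>2 - \<eta>\<close> is exactly
    \<open>\<delta> * (measure M B)\<^sup>2\<close>.\<close>
  define \<eta> where "\<eta> = (1 - \<delta>) * (measure M B)\<^sup>2"
  have "\<eta> > 0" using B(2) \<delta> by (simp add: \<eta>_def)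
  then have "\<forall>\<^sub>F N in sequentially. (measure M B)\<^sup>2 - \<eta>
      < avg (F N) (\<lambda>u. \<integral>x. koopman (add_map u) f x * koopman (mult_map u) f x \<partial>M)"
    using koopman.avg_correlation_ge[OF assms(2) F(1,3) f e] e_inv fe by simp
  then obtain N where N: "(measure M B)\<^sup>2 - \<eta>
      < avg (F N) (\<lambda>u. \<integral>x. koopman (add_map u) f x * koopman (mult_map u) f x \<partial>M)"
    by (auto simp: eventually_sequentially)
  also have "\<dots> \<le> avg (F N) (\<lambda>u. \<delta> * (measure M B)\<^sup>2)"
  proof (rule avg_mono)
    fix u assume u: "u \<in> F N"
    let ?A = "(T (mult_map u) -` B \<inter> space M) \<inter> (T (add_map u) -` B \<inter> space M)"
    have "(\<lambda>x. koopman (add_map u) f x * koopman (mult_map u) f x) = indicator ?A"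
      by (auto simp: koopman_def f_def indicator_def fun_eq_iff)
    then have "(\<integral>x. koopman (add_map u) f x * koopman (mult_map u) f x \<partial>M) = measure M ?A"
      by (simp add: Int_absorb2 le_infI1)
    also have "\<dots> \<le> \<delta> * (measure M B)\<^sup>2"
      using F(2)[of N] F(3)[of N] u by (force simp: return_set_def)
    finally show "(\<integral>x. koopman (add_map u) f x * koopman (mult_map u) f x \<partial>M) \<le> \<delta> * (measure M B)\<^sup>2" .
  qed
  also have "\<dots> = (measure M B)\<^sup>2 - \<eta>"
    using F(1) by (simp add: avg_const double_folner_finite double_folner_nonempty \<eta>_def algebra_simps)
  finally show False by simp
qed

end

theorem proposition1p6:
  assumes "countable (UNIV :: 'k::field set)"
    and "infinite (UNIV :: 'k set)"
  shows "(\<forall>S :: 'k set. affinely_syndetic S \<longleftrightarrow>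
            (\<forall>F. double_folner F \<longrightarrow> upper_density F S > 0)) \<and>
         (\<forall>(M :: 'x measure) (T :: ('k \<Rightarrow> 'k) \<Rightarrow> 'x \<Rightarrow> 'x) B \<delta>.
            affine_pmp_system M T \<longrightarrow> B \<in> sets M \<longrightarrow> measure M B > 0 \<longrightarrow>
            0 < \<delta> \<longrightarrow> \<delta> < 1 \<longrightarrow> affinely_syndetic (return_set M T B \<delta>))"
proof (intro conjI allI impI)
  fix S :: "'k set"
  show "affinely_syndetic S \<longleftrightarrow> (\<forall>F. double_folner F \<longrightarrow> upper_density F S > 0)"
    using assms by (rule affinely_syndetic_iff_upper_density_pos)
next
  fix M :: "'x measure" and T :: "('k \<Rightarrow> 'k) \<Rightarrow> 'x \<Rightarrow> 'x" and B and \<delta> :: real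
  assume "affine_pmp_system M T" "B \<in> sets M" "measure M B > 0" "\<delta> < 1"
  with assms show "affinely_syndetic (return_set M T B \<delta>)"
    by (intro affine_pmp_system.affinely_syndetic_return_set)
qed

end
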